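(* Let $\mu$ be a Borel probability measure on the unit circle $\partial\mathbb{D}$ whose support is not a finite set, with Verblunsky coefficients $\alpha=\{\alpha_n\}_{n=0}^\infty\in\mathbb{D}^\infty$ and Lebesgue decomposition $d\mu = w(\theta)\frac{d\theta}{2\pi}+d\mu_{\mathrm s}$. Assume that $\delta\alpha\in\ell^1$. If $\alpha\in\ell^p$ for some $p\in\mathbb{N}=\{1,2,\dots\}$, then $\operatorname{supp}\mu_{\mathrm s}\subset\{1\}$, $w(\theta)$ is strictly positive and continuous on $e^{i\theta}\in\partial\mathbb{D}\setminus\{1\}$, and \[ |\log w(\theta)| = O\!\left(\frac{1}{|\theta|^{p-1}}\right),\qquad \theta\to0. \]
   Context: $\mathbb{D}=\{z\in\mathbb{C}:|z|<1\}$ and $\partial\mathbb{D}$ is the unit circle, parametrized by $z=e^{i\theta}$; $w$ is regarded as a $2\pi$-periodic function of $\theta$, and $\theta\to 0$ is two-sided with $\theta\neq0$. Verblunsky coefficients: let $\mu$ be a Borel probability measure on $\partial\mathbb{D}$ whose support is not a finite set. Let $\varphi_n(z)$, $\deg\varphi_n=n$, be the orthonormal polynomials obtained by orthonormalizing (Gram--Schmidt, positive leading coefficients) the sequence $1,z,z^2,\dots$ in $L^2(\partial\mathbb{D},d\mu)$. They obey the recursion \[ \varphi_{n+1}(z)=\frac{1}{\sqrt{1-|\alpha_n|^2}}\left(z\varphi_n(z)-\bar\alpha_n z^n\overline{\varphi_n(1/\bar z)}\right),\qquad n\ge 0, \] for uniquely determined $\alpha_n\in\mathbb{D}$, the Verblunsky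 coefficients of $\mu$. The map $\mu\mapsto\alpha=\{\alpha_n\}_{n=0}^\infty$ is a bijection from such measures onto $\mathbb{D}^\infty$. In the Lebesgue decomposition, $w\ge0$ is the density of the absolutely continuous part and $\mu_{\mathrm s}$ is singular with respect to Lebesgue measure. Since $w$ is determined only up to Lebesgue-null sets, pointwise statements about $w$ (continuity, positivity, the asymptotic bound) are understood, as usual, for the suitable (continuous) representative of $w$ on $\partial\mathbb{D}\setminus\{1\}$. $\delta$ is the forward difference: $(\delta\alpha)_n=\alpha_{n+1}-\alpha_n$ for $n\ge0$. *)

theory Defs
  imports "HOL-Analysis.Analysis" "HOL-Probability.Probability_Measure" "HOL-Library.Landau_Symbols"
begin

text \<open>Measures on the unit circle are measures over the Borel sets of the subspace \<open>sphere 0 1\<close>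
  of the complex plane.\<close>

abbreviation circle_borel :: "complex measure" where
  "circle_borel \<equiv> restrict_space borel (sphere 0 1)"

definition circle_prob_measure :: "complex measure \<Rightarrow> bool" where
  "circle_prob_measure \<mu> \<longleftrightarrow> prob_space \<mu> \<and> sets \<mu> = sets circle_borel"

definition measure_support :: "'a::topological_space measure \<Rightarrow> 'a set" where
  "measure_support \<mu> =
     {z \<in> space \<mu>. \<forall>U. open U \<longrightarrow> z \<in> U \<longrightarrow> emeasure \<mu> (U \<inter> space \<mu>) > 0}"

text \<open>The measure \<open>d\<theta> / 2\<pi>\<close>, on one period of the angle variable and on the circle.\<close>

definition angle_measure :: "real measure" where
  "angle_measure = uniform_measure lborel {0..<2 * pi}"

definition circle_lebesgue :: "complex measure" where
  "circle_lebesgue = distr angle_measure circle_borel cis"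

text \<open>\<open>d\<mu> = w(\<theta>) d\<theta>/2\<pi> + d\<mu>\<^sub>s\<close>, where \<open>w\<close> is a \<open>2\<pi>\<close>-periodic function of the angle, so that the
  absolutely continuous part is the push-forward of \<open>w(\<theta>) d\<theta>/2\<pi>\<close> under \<open>\<theta> \<mapsto> e^{i\<theta>}\<close>. This
  fixes \<open>w\<close> only up to Lebesgue-null sets.\<close>

definition circle_lebesgue_decomposition ::
    "complex measure \<Rightarrow> (real \<Rightarrow> real) \<Rightarrow> complex measure \<Rightarrow> bool" where
  "circle_lebesgue_decomposition \<mu> w \<mu>s \<longleftrightarrow>
     w \<in> borel_measurable borel \<and> (\<forall>\<theta>. 0 \<le> w \<theta>) \<and> (\<forall>\<theta>. w (\<theta> + 2 * pi) = w \<theta>) \<and>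
     sets \<mu>s = sets circle_borel \<and>
     (\<exists>N \<in> sets circle_borel.
        emeasure circle_lebesgue N = 0 \<and> emeasure \<mu>s (sphere 0 1 - N) = 0) \<and>
     (\<forall>A \<in> sets circle_borel.
        emeasure \<mu> A =
          emeasure (distr (density angle_measure (\<lambda>\<theta>. ennreal (w \<theta>))) circle_borel cis) A
          + emeasure \<mu>s A)"

definition poly_inner :: "complex measure \<Rightarrow> complex poly \<Rightarrow> complex poly \<Rightarrow> complex" where
  "poly_inner \<mu> p q = (LINT z|\<mu>. cnj (poly p z) * poly q z)"

definition poly_norm :: "complex measure \<Rightarrow> complex poly \<Rightarrow> real" where
  "poly_norm \<mu> p = sqrt (LINT z|\<mu>. (cmod (poly p z))\<^sup>2)"

text \<open>Gram--Schmidt applied to \<open>1, z, z\<^sup>2, \<dots>\<close>; the leading coefficient is the reciprocal of a norm,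
  hence positive when the support of \<open>\<mu>\<close> is infinite.\<close>

fun orthonormal_poly :: "complex measure \<Rightarrow> nat \<Rightarrow> complex poly" where
  "orthonormal_poly \<mu> n =
     (let P = monom 1 n -
            (\<Sum>k<n. smult (poly_inner \<mu> (orthonormal_poly \<mu> k) (monom 1 n)) (orthonormal_poly \<mu> k))
      in smult (complex_of_real (1 / poly_norm \<mu> P)) P)"

declare orthonormal_poly.simps [simp del]

text \<open>The recursion is an identity of polynomials, so requiring it for \<open>z \<noteq> 0\<close>, where \<open>1 / cnj z\<close>
  is meaningful, loses nothing.\<close>

definition verblunsky_coefficients :: "complex measure \<Rightarrow> (nat \<Rightarrow> complex) \<Rightarrow> bool" where
  "verblunsky_coefficients \<mu> \<alpha> \<longleftrightarrow>
     (\<forall>n. cmod (\<alpha> n) < 1 \<and>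
        (\<forall>z. z \<noteq> 0 \<longrightarrow>
           poly (orthonormal_poly \<mu> (Suc n)) z =
             1 / complex_of_real (sqrt (1 - (cmod (\<alpha> n))\<^sup>2)) *
             (z * poly (orthonormal_poly \<mu> n) z
              - cnj (\<alpha> n) * z ^ n * cnj (poly (orthonormal_poly \<mu> n) (1 / cnj z)))))"

definition in_little_l :: "nat \<Rightarrow> (nat \<Rightarrow> complex) \<Rightarrow> bool" where
  "in_little_l p a \<longleftrightarrow> summable (\<lambda>n. cmod (a n) ^ p)"

definition forward_diff :: "(nat \<Rightarrow> complex) \<Rightarrow> nat \<Rightarrow> complex" where
  "forward_diff a n = a (Suc n) - a n"

end

theory Submission
  imports Defs
begin

text \<open>On \<open>\<bar>z\<bar> = 1\<close> write \<open>X\<^sub>n = \<bar>\<phi>\<^sub>n\<bar>\<^sup>2\<close>. Since \<open>\<alpha> \<longlonglongrightarrow> 0\<close>, the recursion says that \<open>z \<phi>\<^sub>n\<close> is nearly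
  \<open>\<phi>\<^sub>n\<^sub>+\<^sub>1\<close>, so by orthonormality the measures \<open>X\<^sub>n d\<mu>\<close> converge weakly to \<open>d\<theta>/2\<pi>\<close>. If \<open>ln X\<^sub>n\<close>
  converges to \<open>L\<close> locally uniformly off \<open>z = 1\<close>, then \<open>exp L d\<mu> = d\<theta>/2\<pi>\<close> there: the singular part
  lives on \<open>{1}\<close> and \<open>w = exp (- L)\<close>.

  For a constant coefficient \<open>a\<close> with \<open>\<bar>a\<bar>\<close> small compared with \<open>\<bar>z - 1\<bar>\<close> the transfer matrix is
  elliptic and preserves a definite form, comparable to \<open>X\<^sub>n\<close>. Along the recursion the logarithm of
  this form changes by \<open>O(\<bar>\<delta>\<alpha>\<^sub>n\<bar> / \<bar>z - 1\<bar>)\<close> at elliptic steps, and by \<open>O(\<bar>\<alpha>\<^sub>n\<bar>)\<close> more at the others,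
  where \<open>\<bar>\<alpha>\<^sub>n\<bar> > \<bar>z - 1\<bar> / 4\<close> and hence \<open>\<bar>\<alpha>\<^sub>n\<bar> \<le> \<bar>\<alpha>\<^sub>n\<bar>\<^sup>p (4 / \<bar>z - 1\<bar>)\<^sup>p\<^sup>-\<^sup>1\<close>. Summing gives convergence and
  \<open>L = O(\<bar>z - 1\<bar>\<^sup>1\<^sup>-\<^sup>p)\<close> for \<open>p \<ge> 2\<close>; for \<open>p = 1\<close> the crude bound \<open>O(\<bar>\<alpha>\<^sub>n\<bar>)\<close> per step suffices.\<close>

section \<open>The invariant form of the recursion\<close>

text \<open>The one-step estimates for logarithms rest on this: a common lower bound turns an
  absolute error into a logarithmic one.\<close>

lemma abs_ln_diff_le:
  fixes x y m :: real
  assumes "0 < m" "m \<le> x" "m \<le> y"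
  shows "\<bar>ln x - ln y\<bar> \<le> \<bar>x - y\<bar> / m"
proof -
  have *: "ln a - ln b \<le> \<bar>a - b\<bar> / m" if "m \<le> a" "m \<le> b" for a b
  proof -
    have "a > 0" "b > 0" using assms(1) that by linarith+
    then have "ln a - ln b \<le> (a - b) / b"
      using ln_diff_le by blast
    also have "\<dots> \<le> \<bar>a - b\<bar> / b"
      using \<open>b > 0\<close> by (intro divide_right_mono) auto
    also have "\<dots> \<le> \<bar>a - b\<bar> / m"
      using assms(1) that by (intro divide_left_mono) auto
    finally show ?thesis .
  qed
  from *[of x y] *[of y x] assms show ?thesis
    by (simp add: abs_minus_commute abs_le_iff)
qed

text \<open>This depends on \<alpha> alone, so the recursion can be analysed apart from \<mu>. It
  uses \<open>1 / cnj z = z\<close>, hence its values are those of the orthonormal polynomials on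
  the unit circle only.\<close>

fun szego :: "(nat \<Rightarrow> complex) \<Rightarrow> nat \<Rightarrow> complex \<Rightarrow> complex" where
  "szego \<alpha> 0 z = 1"
| "szego \<alpha> (Suc n) z =
     (z * szego \<alpha> n z - cnj (\<alpha> n) * z ^ n * cnj (szego \<alpha> n z))
       / complex_of_real (sqrt (1 - (cmod (\<alpha> n))\<^sup>2))"

declare szego.simps(2) [simp del]

lemma continuous_on_szego: "continuous_on S (szego \<alpha> n)"
proof (induction n)
  case (Suc n)
  have "continuous_on S (\<lambda>z. (z * szego \<alpha> n z - cnj (\<alpha> n) * z ^ n * cnj (szego \<alpha> n z))
       * inverse (complex_of_real (sqrt (1 - (cmod (\<alpha> n))\<^sup>2))))"
    by (intro continuous_intros Suc)
  then show ?case by (simp add: szego.simps(2) divide_inverse)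
qed simp

definition szego_sq :: "(nat \<Rightarrow> complex) \<Rightarrow> nat \<Rightarrow> complex \<Rightarrow> real" where
  "szego_sq \<alpha> n z = (cmod (szego \<alpha> n z))\<^sup>2"

text \<open>On the unit circle this is \<open>\<phi>\<^sub>n\<close> times the conjugate of \<open>\<phi>\<^sub>n\<^sup>*\<close>.\<close>

definition szego_cross :: "(nat \<Rightarrow> complex) \<Rightarrow> nat \<Rightarrow> complex \<Rightarrow> complex" where
  "szego_cross \<alpha> n z = (szego \<alpha> n z)\<^sup>2 * cnj z ^ n"

lemma continuous_on_szego_sq: "continuous_on S (szego_sq \<alpha> n)"
  unfolding szego_sq_def by (intro continuous_intros continuous_on_szego)

text \<open>The transfer matrix with constant coefficient \<open>b\<close> preserves, besides the form
  \<open>\<bar>\<phi>\<bar>\<^sup>2 - \<bar>\<phi>\<^sup>*\<bar>\<^sup>2\<close>, the Hermitian form given by its own traceless part. Normalised and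
  restricted to \<open>\<bar>\<phi>\<bar> = \<bar>\<phi>\<^sup>*\<bar>\<close> it is the following expression.\<close>

definition szego_energy :: "(nat \<Rightarrow> complex) \<Rightarrow> nat \<Rightarrow> complex \<Rightarrow> complex \<Rightarrow> real" where
  "szego_energy \<alpha> n z b = szego_sq \<alpha> n z + 2 * Re (z / (z - 1) * b * szego_cross \<alpha> n z)"

lemma cnj_circle:
  assumes "cmod z = 1" shows "cnj z = inverse z" "z \<noteq> 0" "z * cnj z = 1"
proof -
  show *: "z * cnj z = 1" using assms by (metis complex_norm_square of_real_1 power_one)
  then show "cnj z = inverse z" by (metis inverse_unique)
  show "z \<noteq> 0" using assms by auto
qed

text \<open>Expanding the squared modulus, with \<open>z * cnj z = 1\<close>, produces only
  \<open>szego_sq\<close> and \<open>szego_cross\<close>. With the next formula the pair obeys a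
  real-linear recursion of its own: the action of the transfer matrix on quadratic
  expressions.\<close>

lemma szego_sq_Suc:
  assumes "cmod z = 1" "cmod (\<alpha> n) < 1"
  shows "(1 - (cmod (\<alpha> n))\<^sup>2) * szego_sq \<alpha> (Suc n) z =
    (1 + (cmod (\<alpha> n))\<^sup>2) * szego_sq \<alpha> n z - 2 * Re (\<alpha> n * z * szego_cross \<alpha> n z)"
proof -
  define f where "f = szego \<alpha> n z"
  define d where "d = 1 - (cmod (\<alpha> n))\<^sup>2"
  have d: "d > 0" using assms unfolding d_def by (simp add: power_less_one_iff abs_square_less_1)
  have z: "z * cnj z = 1" using cnj_circle[OF assms(1)] by simp
  have zn: "z ^ n * cnj z ^ n = 1" using z by (metis power_mult_distrib power_one)
  have "szego_sq \<alpha> (Suc n) z = (cmod (z * f - cnj (\<alpha> n) * z ^ n * cnj f))\<^sup>2 / d"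
    using d by (simp add: szego.simps(2) szego_sq_def f_def[symmetric] d_def[symmetric] norm_divide power_divide)
  then have 1: "d * szego_sq \<alpha> (Suc n) z = (cmod (z * f - cnj (\<alpha> n) * z ^ n * cnj f))\<^sup>2"
    using d by simp
  have "complex_of_real ((cmod (z * f - cnj (\<alpha> n) * z ^ n * cnj f))\<^sup>2) =
     (z * f - cnj (\<alpha> n) * z ^ n * cnj f) * (cnj z * cnj f - \<alpha> n * cnj z ^ n * f)"
    unfolding complex_norm_square by simp
  also have "\<dots> = (z * cnj z) * (f * cnj f) + \<alpha> n * cnj (\<alpha> n) * (z ^ n * cnj z ^ n) * (f * cnj f)
      - (\<alpha> n * z * (f\<^sup>2 * cnj z ^ n) + cnj (\<alpha> n * z * (f\<^sup>2 * cnj z ^ n)))"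
    unfolding complex_cnj_mult complex_cnj_power complex_cnj_cnj by algebra
  also have "\<dots> = complex_of_real ((1 + (cmod (\<alpha> n))\<^sup>2) * (cmod f)\<^sup>2 - 2 * Re (\<alpha> n * z * (f\<^sup>2 * cnj z ^ n)))"
    unfolding z zn complex_add_cnj by (simp add: complex_norm_square[symmetric] distrib_right flip: of_real_power of_real_mult)
  finally have "(cmod (z * f - cnj (\<alpha> n) * z ^ n * cnj f))\<^sup>2 =
      (1 + (cmod (\<alpha> n))\<^sup>2) * (cmod f)\<^sup>2 - 2 * Re (\<alpha> n * z * (f\<^sup>2 * cnj z ^ n))"
    using of_real_eq_iff by blast
  with 1 show ?thesis by (simp only: d_def szego_sq_def szego_cross_def f_def)
qed

lemma szego_cross_Suc:
  assumes "cmod z = 1" "cmod (\<alpha> n) < 1"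
  shows "(1 - (cmod (\<alpha> n))\<^sup>2) * szego_cross \<alpha> (Suc n) z =
    z * szego_cross \<alpha> n z - 2 * cnj (\<alpha> n) * szego_sq \<alpha> n z
      + (cnj (\<alpha> n))\<^sup>2 * cnj z * cnj (szego_cross \<alpha> n z)"
proof -
  define f where "f = szego \<alpha> n z"
  define d where "d = 1 - (cmod (\<alpha> n))\<^sup>2"
  have d: "d > 0" using assms unfolding d_def by (simp add: power_less_one_iff abs_square_less_1)
  have z: "z * cnj z = 1" using cnj_circle[OF assms(1)] by simp
  have zn: "z ^ n * cnj z ^ n = 1" using z by (metis power_mult_distrib power_one)
  have "szego_cross \<alpha> (Suc n) z = (z * f - cnj (\<alpha> n) * z ^ n * cnj f)\<^sup>2 / (complex_of_real (sqrt d))\<^sup>2 * cnj z ^ Suc n"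
    by (simp add: szego.simps(2) szego_cross_def f_def[symmetric] d_def[symmetric] power_divide)
  also have "(complex_of_real (sqrt d))\<^sup>2 = d" using d by (simp flip: of_real_power)
  finally have "d * szego_cross \<alpha> (Suc n) z = (z * f - cnj (\<alpha> n) * z ^ n * cnj f)\<^sup>2 * cnj z ^ Suc n"
    using d by simp
  also have "\<dots> = (z * cnj z) * (z * (f\<^sup>2 * cnj z ^ n)) 
     - 2 * cnj (\<alpha> n) * (z ^ n * cnj z ^ n) * (z * cnj z) * (f * cnj f)
     + (cnj (\<alpha> n))\<^sup>2 * (z ^ n * cnj z ^ n) * cnj z * cnj (f\<^sup>2 * cnj z ^ n)"
    by (simp add: algebra_simps power2_eq_square)
  also have "\<dots> = z * (f\<^sup>2 * cnj z ^ n) - 2 * cnj (\<alpha> n) * complex_of_real ((cmod f)\<^sup>2)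
     + (cnj (\<alpha> n))\<^sup>2 * cnj z * cnj (f\<^sup>2 * cnj z ^ n)"
    unfolding z zn complex_norm_square by simp
  finally show ?thesis by (simp add: d_def szego_sq_def szego_cross_def f_def)
qed

lemma norm_szego_cross: "cmod z = 1 \<Longrightarrow> cmod (szego_cross \<alpha> n z) = szego_sq \<alpha> n z"
  by (simp add: szego_cross_def szego_sq_def norm_mult norm_power)

text \<open>The two update formulas are substituted after clearing the denominator. The rest cancels
  by three identities for \<open>c = z / (z - 1)\<close>, two of which use that z lies on the
  circle.\<close>

lemma szego_energy_Suc:
  assumes "cmod z = 1" "z \<noteq> 1" "cmod (\<alpha> n) < 1"
  shows "szego_energy \<alpha> (Suc n) z (\<alpha> n) = szego_energy \<alpha> n z (\<alpha> n)"
proof -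
  define a c X Y where "a = \<alpha> n" and "c = z / (z - 1)" and "X = szego_sq \<alpha> n z"
    and "Y = szego_cross \<alpha> n z"
  define d where "d = 1 - (cmod a)\<^sup>2"
  have d: "d > 0" using assms unfolding d_def a_def by (simp add: power_less_one_iff abs_square_less_1)
  have z: "cnj z = inverse z" "z \<noteq> 0" using cnj_circle[OF assms(1)] by auto
  have c1: "c * z - z = c" "cnj c * z = - c" "c + cnj c = 1"
    unfolding c_def using z assms(2) by (auto simp: divide_simps) (auto simp: algebra_simps)
  have cr: "2 * Re c = 1" using c1(3) complex_add_cnj[of c] by (metis of_real_eq_1_iff)
  have "d * szego_energy \<alpha> (Suc n) z a = (1 + (cmod a)\<^sup>2) * X - 2 * Re (a * z * Y)
     + 2 * Re (c * a * (z * Y - 2 * cnj a * X + (cnj a)\<^sup>2 * cnj z * cnj Y))"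
  proof -
    have R: "Re (complex_of_real r * W) = r * Re W" for r and W :: complex by simp
    have 1: "Re (c * a * (d * W)) = d * Re (c * a * W)" for W :: complex
    proof -
      have "Re (c * a * (d * W)) = Re (complex_of_real d * (c * a * W))" by (simp only: mult_ac)
      also have "\<dots> = d * Re (c * a * W)" by (rule R)
      finally show ?thesis .
    qed
    have "d * szego_energy \<alpha> (Suc n) z a =
        d * szego_sq \<alpha> (Suc n) z + 2 * (d * Re (c * a * szego_cross \<alpha> (Suc n) z))"
      unfolding szego_energy_def c_def[symmetric] by (simp only: distrib_left mult.left_commute)
    also have "d * Re (c * a * szego_cross \<alpha> (Suc n) z) = Re (c * a * (d * szego_cross \<alpha> (Suc n) z))"
      by (rule 1[symmetric])
    also have "d * szego_cross \<alpha> (Suc n) z = z * Y - 2 * cnj a * X + (cnj a)\<^sup>2 * cnj z * cnj Y"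
      unfolding d_def a_def X_def Y_def using szego_cross_Suc[of z \<alpha> n, OF assms(1,3)] .
    also have "d * szego_sq \<alpha> (Suc n) z = (1 + (cmod a)\<^sup>2) * X - 2 * Re (a * z * Y)"
      unfolding d_def a_def X_def Y_def using szego_sq_Suc[of z \<alpha> n, OF assms(1,3)] .
    finally show ?thesis .
  qed
  also have "c * a * (z * Y - 2 * cnj a * X + (cnj a)\<^sup>2 * cnj z * cnj Y) =
      c * z * a * Y - 2 * (a * cnj a) * X * c + (a * cnj a) * cnj (cnj c * z * a * Y)"
    by (simp add: algebra_simps power2_eq_square)
  also have "\<dots> = (c + z) * a * Y - complex_of_real ((cmod a)\<^sup>2 * X) * (2 * c)
      - complex_of_real ((cmod a)\<^sup>2) * cnj (c * a * Y)"
    using c1 by (simp add: complex_norm_square[symmetric] algebra_simps)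
  also have "Re \<dots> = Re (c * a * Y) + Re (z * a * Y) - (cmod a)\<^sup>2 * X - (cmod a)\<^sup>2 * Re (c * a * Y)"
    using cr by (simp add: algebra_simps)
  finally have "d * szego_energy \<alpha> (Suc n) z a = d * szego_energy \<alpha> n z a"
    unfolding szego_energy_def c_def[symmetric] X_def[symmetric] Y_def[symmetric] d_def
    by (simp add: algebra_simps)
  with d show ?thesis by (simp add: a_def)
qed

text \<open>The form is affine in its coefficient, and the Lipschitz constant comes from
  \<open>norm_szego_cross\<close>. At coefficient \<open>0\<close> the form is
  \<open>szego_sq\<close>, so this also compares the two.\<close>

lemma szego_energy_diff:
  assumes z: "cmod z = 1"
  shows "\<bar>szego_energy \<alpha> n z b - szego_energy \<alpha> n z b'\<bar> \<le> 2 * cmod (b - b') / cmod (z - 1) * szego_sq \<alpha> n z"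
proof -
  have "szego_energy \<alpha> n z b - szego_energy \<alpha> n z b' = 2 * Re (z / (z - 1) * (b - b') * szego_cross \<alpha> n z)"
    unfolding szego_energy_def left_diff_distrib right_diff_distrib minus_complex.sel by simp
  also have "\<bar>\<dots>\<bar> \<le> 2 * cmod (z / (z - 1) * (b - b') * szego_cross \<alpha> n z)"
    using abs_Re_le_cmod[of "z / (z - 1) * (b - b') * szego_cross \<alpha> n z"] by linarith
  finally show ?thesis using z by (simp add: norm_mult norm_divide norm_szego_cross)
qed

text \<open>This is the origin of the factor 1/4 in \<open>clip\<close>: the cross term takes away
  at most half of \<open>szego_sq\<close>, so the form stays positive and has a logarithm.\<close>

lemma szego_energy_ge:
  assumes z: "cmod z = 1" "z \<noteq> 1" and b: "cmod b \<le> cmod (z - 1) / 4"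
  shows "szego_sq \<alpha> n z / 2 \<le> szego_energy \<alpha> n z b"
proof -
  have "\<bar>szego_energy \<alpha> n z b - szego_sq \<alpha> n z\<bar> \<le> 2 * cmod b / cmod (z - 1) * szego_sq \<alpha> n z"
    using szego_energy_diff[OF z(1), of \<alpha> n b 0] by (simp add: szego_energy_def)
  also have "\<dots> \<le> 1 / 2 * szego_sq \<alpha> n z"
    using z b by (intro mult_right_mono) (auto simp: szego_sq_def divide_simps)
  finally show ?thesis by linarith
qed

text \<open>The invariance of the energy is only useful while the coefficient is small compared with
  \<open>\<bar>z - 1\<bar>\<close> (the elliptic regime), so larger coefficients are replaced by their projection to a disc.\<close>

definition clip :: "complex \<Rightarrow> complex \<Rightarrow> complex" where
  "clip z a = closest_point (cball 0 (cmod (z - 1) / 4)) a"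

lemma clip_le: "cmod (clip z a) \<le> cmod (z - 1) / 4"
proof -
  have "clip z a \<in> cball 0 (cmod (z - 1) / 4)"
    unfolding clip_def by (intro closest_point_in_set) auto
  then show ?thesis by simp
qed

text \<open>Projection to a convex set is nonexpansive, so clipping does not increase the variation
  of \<alpha>.\<close>

lemma clip_diff_le: "cmod (clip z a - clip z b) \<le> cmod (a - b)"
  using closest_point_lipschitz[of "cball 0 (cmod (z - 1) / 4)" a b]
  by (simp add: clip_def dist_norm)

lemma clip_self: "cmod a \<le> cmod (z - 1) / 4 \<Longrightarrow> clip z a = a"
  unfolding clip_def by (intro closest_point_self) auto

lemma clip_le': "cmod (clip z a) \<le> cmod a"
  using clip_diff_le[of z a 0] clip_self[of 0 z] by simp

definition ln_energy :: "(nat \<Rightarrow> complex) \<Rightarrow> nat \<Rightarrow> complex \<Rightarrow> real" where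
  "ln_energy \<alpha> n z = ln (szego_energy \<alpha> n z (clip z (\<alpha> n)))"

text \<open>A majorant without z for the increments of \<open>ln_energy\<close> where
  \<open>\<epsilon> \<le> cmod (z - 1)\<close>. The first term pays for the change of coefficient,
  the second for steps outside the elliptic regime.\<close>

definition step_bound :: "(nat \<Rightarrow> complex) \<Rightarrow> real \<Rightarrow> real \<Rightarrow> nat \<Rightarrow> real" where
  "step_bound \<alpha> \<kappa> \<epsilon> n = 4 * cmod (\<alpha> (Suc n) - \<alpha> n) / \<epsilon>
     + (if \<epsilon> / 4 < cmod (\<alpha> n) then 64 * cmod (\<alpha> n) / \<kappa>\<^sup>2 else 0)"

text \<open>The value of the limit of \<open>ln \<bar>\<phi>\<^sub>n\<bar>\<^sup>2\<close>, as a telescoping series.\<close>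

definition ln_limit :: "(nat \<Rightarrow> complex) \<Rightarrow> complex \<Rightarrow> real" where
  "ln_limit \<alpha> z = ln_energy \<alpha> 0 z + (\<Sum>n. ln_energy \<alpha> (Suc n) z - ln_energy \<alpha> n z)"

text \<open>\<open>ln_limit\<close> is controlled only off \<open>1\<close>. The indicator removes
  this point, which is null for Lebesgue measure, and makes the density Borel on the whole
  plane.\<close>

definition circle_density :: "(nat \<Rightarrow> complex) \<Rightarrow> complex \<Rightarrow> real" where
  "circle_density \<alpha> z = indicator (sphere 0 1 - {1}) z * exp (- ln_limit \<alpha> z)"

lemma circle_density_nonneg: "circle_density \<alpha> z \<ge> 0"
  by (simp add: circle_density_def)

section \<open>Convergence of the logarithms\<close>

context
  fixes \<alpha> :: "nat \<Rightarrow> complex" and \<kappa> :: real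
  assumes \<kappa>_pos: "0 < \<kappa>" and \<kappa>_le: "\<And>n. \<kappa> \<le> 1 - (cmod (\<alpha> n))\<^sup>2"
begin

lemma coeff_less_1: "cmod (\<alpha> n) < 1"
proof -
  have "(cmod (\<alpha> n))\<^sup>2 < 1" using \<kappa>_pos \<kappa>_le[of n] by linarith
  then show ?thesis using abs_square_less_1[of "cmod (\<alpha> n)"] by simp
qed

lemma kappa_le_1: "\<kappa> \<le> 1"
  using \<kappa>_le[of 0] zero_le_power2[of "cmod (\<alpha> 0)"] by linarith

text \<open>With \<open>a = cmod (\<alpha> n)\<close> and \<open>d = 1 - a^2\<close>, the crude
  bound on the cross term in the update formula leaves the factor \<open>(1 - a)^2\<close>. Since
  \<open>d \<le> 2 * (1 - a)\<close>, this is at least \<open>d^2 / 4\<close>, and one factor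
  \<open>d\<close> cancels.\<close>

lemma szego_sq_Suc_ge:
  assumes z: "cmod z = 1"
  shows "\<kappa> / 4 * szego_sq \<alpha> n z \<le> szego_sq \<alpha> (Suc n) z"
proof -
  define a X X' d where "a = cmod (\<alpha> n)" and "X = szego_sq \<alpha> n z"
    and "X' = szego_sq \<alpha> (Suc n) z" and "d = 1 - a\<^sup>2"
  have a: "0 \<le> a" "a < 1" using coeff_less_1 by (auto simp: a_def)
  have d: "\<kappa> \<le> d" "d > 0" using \<kappa>_le[of n] \<kappa>_pos by (auto simp: d_def a_def)
  have X: "X \<ge> 0" by (simp add: X_def szego_sq_def)
  have "\<bar>Re (\<alpha> n * z * szego_cross \<alpha> n z)\<bar> \<le> a * X"
    using abs_Re_le_cmod[of "\<alpha> n * z * szego_cross \<alpha> n z"] z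
    by (simp add: norm_mult norm_szego_cross a_def X_def)
  then have "d * X' \<ge> (1 + a\<^sup>2) * X - 2 * (a * X)"
    using szego_sq_Suc[of z \<alpha> n, OF z coeff_less_1] unfolding X_def[symmetric] X'_def[symmetric] a_def[symmetric] d_def[symmetric]
    by linarith
  then have 1: "d * X' \<ge> (1 - a)\<^sup>2 * X" by (simp add: power2_eq_square algebra_simps)
  have "d / 2 \<le> 1 - a"
  proof -
    have "d = (1 - a) * (1 + a)" by (simp add: d_def power2_eq_square algebra_simps)
    also have "\<dots> \<le> (1 - a) * 2" using a by (intro mult_left_mono) auto
    finally show ?thesis by simp
  qed
  then have "(d / 2)\<^sup>2 * X \<le> (1 - a)\<^sup>2 * X"
    using d X by (intro mult_right_mono power_mono) auto
  with 1 have "d * (d / 4 * X) \<le> d * X'" by (simp add: power2_eq_square)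
  then have "d / 4 * X \<le> X'" using d by (simp only: mult_le_cancel_left_pos)
  moreover have "\<kappa> / 4 * X \<le> d / 4 * X" using d X by (intro mult_right_mono) auto
  ultimately show ?thesis by (simp add: X_def X'_def)
qed

lemma szego_sq_pos:
  assumes "cmod z = 1"
  shows "szego_sq \<alpha> n z > 0"
proof (induction n)
  case (Suc n)
  then show ?case using szego_sq_Suc_ge[OF assms, of n] \<kappa>_pos
    by (smt (verit) divide_pos_pos mult_pos_pos)
qed (simp add: szego_sq_def)

lemma szego_sq_step:
  assumes z: "cmod z = 1"
  shows "\<bar>szego_sq \<alpha> (Suc n) z - szego_sq \<alpha> n z\<bar> \<le> 4 * cmod (\<alpha> n) / \<kappa> * szego_sq \<alpha> n z"
proof -
  define a X X' d where "a = cmod (\<alpha> n)" and "X = szego_sq \<alpha> n z"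
    and "X' = szego_sq \<alpha> (Suc n) z" and "d = 1 - a\<^sup>2"
  have a: "0 \<le> a" "a < 1" using coeff_less_1 by (auto simp: a_def)
  have d: "\<kappa> \<le> d" "d > 0" using \<kappa>_le[of n] \<kappa>_pos by (auto simp: d_def a_def)
  have X: "X \<ge> 0" by (simp add: X_def szego_sq_def)
  have r: "\<bar>Re (\<alpha> n * z * szego_cross \<alpha> n z)\<bar> \<le> a * X"
    using abs_Re_le_cmod[of "\<alpha> n * z * szego_cross \<alpha> n z"] z
    by (simp add: norm_mult norm_szego_cross a_def X_def)
  have "d * X' = (1 + a\<^sup>2) * X - 2 * Re (\<alpha> n * z * szego_cross \<alpha> n z)"
    using szego_sq_Suc[of z \<alpha> n, OF z coeff_less_1] unfolding X_def[symmetric] X'_def[symmetric] a_def[symmetric] d_def[symmetric] .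
  then have "d * (X' - X) = 2 * (a\<^sup>2 * X) - 2 * Re (\<alpha> n * z * szego_cross \<alpha> n z)"
    by (simp add: d_def algebra_simps)
  moreover have "0 \<le> a\<^sup>2 * X" "a\<^sup>2 * X \<le> a * X"
    using a X by (auto simp: power2_eq_square intro!: mult_right_mono mult_left_le)
  ultimately have "\<bar>d * (X' - X)\<bar> \<le> 4 * (a * X)" using r by linarith
  moreover have "\<kappa> * \<bar>X' - X\<bar> \<le> \<bar>d * (X' - X)\<bar>"
    using d by (auto simp: abs_mult intro!: mult_right_mono)
  ultimately have "\<kappa> * \<bar>X' - X\<bar> \<le> 4 * (a * X)" by linarith
  then show ?thesis unfolding X_def[symmetric] X'_def[symmetric] a_def[symmetric]
    using \<kappa>_pos by (simp add: field_simps)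
qed

text \<open>The comparison is with \<open>z * szego_cross \<alpha> n z\<close> because the cross
  term rotates by z at each step even for coefficient zero; its plain increments need not be
  small.\<close>

lemma szego_cross_step:
  assumes z: "cmod z = 1"
  shows "cmod (szego_cross \<alpha> (Suc n) z - z * szego_cross \<alpha> n z) \<le> 4 * cmod (\<alpha> n) / \<kappa> * szego_sq \<alpha> n z"
proof -
  define a X Y Y' d where "a = cmod (\<alpha> n)" and "X = szego_sq \<alpha> n z"
    and "Y = szego_cross \<alpha> n z" and "Y' = szego_cross \<alpha> (Suc n) z" and "d = 1 - a\<^sup>2"
  have a: "0 \<le> a" "a < 1" using coeff_less_1 by (auto simp: a_def)
  have d: "\<kappa> \<le> d" "d > 0" using \<kappa>_le[of n] \<kappa>_pos by (auto simp: d_def a_def)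
  have X: "X \<ge> 0" by (simp add: X_def szego_sq_def)
  have nY: "cmod Y = X" using norm_szego_cross z by (simp add: X_def Y_def)
  have "d * Y' = z * Y - 2 * cnj (\<alpha> n) * X + (cnj (\<alpha> n))\<^sup>2 * cnj z * cnj Y"
    using szego_cross_Suc[of z \<alpha> n, OF z coeff_less_1] unfolding X_def[symmetric] Y_def[symmetric] Y'_def[symmetric] a_def[symmetric] d_def[symmetric] .
  then have "d * (Y' - z * Y) = of_real (a\<^sup>2) * (z * Y) - 2 * cnj (\<alpha> n) * X + (cnj (\<alpha> n))\<^sup>2 * cnj z * cnj Y"
    by (simp add: d_def algebra_simps)
  also have "cmod \<dots> \<le> cmod (of_real (a\<^sup>2) * (z * Y) - 2 * cnj (\<alpha> n) * X) + cmod ((cnj (\<alpha> n))\<^sup>2 * cnj z * cnj Y)"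
    by (rule norm_triangle_ineq)
  also have "\<dots> \<le> (cmod (of_real (a\<^sup>2) * (z * Y)) + cmod (2 * cnj (\<alpha> n) * X)) + cmod ((cnj (\<alpha> n))\<^sup>2 * cnj z * cnj Y)"
    using norm_triangle_ineq4 add_right_mono by blast
  also have "\<dots> = 2 * (a\<^sup>2 * X) + 2 * (a * X)"
    using z nY X a by (simp add: norm_mult norm_power a_def[symmetric] del: of_real_power)
  also have "\<dots> \<le> 4 * (a * X)"
  proof -
    have "a\<^sup>2 * X \<le> a * X"
      using a X by (auto simp: power2_eq_square intro!: mult_right_mono mult_left_le)
    then show ?thesis by linarith
  qed
  finally have "d * cmod (Y' - z * Y) \<le> 4 * (a * X)" using d by (simp add: norm_mult)
  moreover have "\<kappa> * cmod (Y' - z * Y) \<le> d * cmod (Y' - z * Y)"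
    using d by (auto intro!: mult_right_mono)
  ultimately have "\<kappa> * cmod (Y' - z * Y) \<le> 4 * (a * X)" by linarith
  then show ?thesis unfolding X_def[symmetric] Y_def[symmetric] Y'_def[symmetric] a_def[symmetric]
    using \<kappa>_pos by (simp add: field_simps)
qed

text \<open>The crude bound makes no use of the invariant form and does not involve
  \<open>cmod (z - 1)\<close>. It is what the case \<open>p = 1\<close> needs.\<close>

lemma ln_szego_sq_step:
  assumes z: "cmod z = 1"
  shows "\<bar>ln (szego_sq \<alpha> (Suc n) z) - ln (szego_sq \<alpha> n z)\<bar> \<le> 16 * cmod (\<alpha> n) / \<kappa>\<^sup>2"
proof -
  have X: "szego_sq \<alpha> n z > 0" by (rule szego_sq_pos[OF z])
  have "\<bar>ln (szego_sq \<alpha> (Suc n) z) - ln (szego_sq \<alpha> n z)\<bar>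
      \<le> \<bar>szego_sq \<alpha> (Suc n) z - szego_sq \<alpha> n z\<bar> / (\<kappa> / 4 * szego_sq \<alpha> n z)"
    using X \<kappa>_pos kappa_le_1 szego_sq_Suc_ge[OF z, of n] by (intro abs_ln_diff_le) auto
  also have "\<dots> \<le> (4 * cmod (\<alpha> n) / \<kappa> * szego_sq \<alpha> n z) / (\<kappa> / 4 * szego_sq \<alpha> n z)"
    using X \<kappa>_pos szego_sq_step[OF z, of n] by (intro divide_right_mono) auto
  also have "\<dots> = 16 * cmod (\<alpha> n) / \<kappa>\<^sup>2"
    using X \<kappa>_pos by (simp add: field_simps power2_eq_square)
  finally show ?thesis .
qed

lemma ln_szego_energy_diff:
  assumes z: "cmod z = 1" "z \<noteq> 1"
    and b: "cmod b \<le> cmod (z - 1) / 4" "cmod b' \<le> cmod (z - 1) / 4"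
  shows "\<bar>ln (szego_energy \<alpha> n z b) - ln (szego_energy \<alpha> n z b')\<bar> \<le> 4 * cmod (b - b') / cmod (z - 1)"
proof -
  have X: "szego_sq \<alpha> n z > 0" by (rule szego_sq_pos[OF z(1)])
  have "\<bar>ln (szego_energy \<alpha> n z b) - ln (szego_energy \<alpha> n z b')\<bar> \<le>
      \<bar>szego_energy \<alpha> n z b - szego_energy \<alpha> n z b'\<bar> / (szego_sq \<alpha> n z / 2)"
    using X szego_energy_ge[OF z b(1)] szego_energy_ge[OF z b(2)] by (intro abs_ln_diff_le) auto
  also have "\<dots> \<le> (2 * cmod (b - b') / cmod (z - 1) * szego_sq \<alpha> n z) / (szego_sq \<alpha> n z / 2)"
    using X szego_energy_diff[OF z(1)] by (intro divide_right_mono) auto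
  also have "\<dots> = 4 * cmod (b - b') / cmod (z - 1)" using X by simp
  finally show ?thesis .
qed

text \<open>Nothing is conserved here, but the rotation error \<open>(z - 1) * Y\<close> is
  absorbed, since \<open>cmod (z - 1)\<close> is at most four times
  \<open>cmod (\<alpha> n)\<close>. Thus the bound is free of \<open>cmod (z - 1)\<close>.\<close>

lemma ln_szego_energy_step:
  assumes z: "cmod z = 1" "z \<noteq> 1"
    and b: "cmod b \<le> cmod (z - 1) / 4" and large: "cmod (z - 1) / 4 \<le> cmod (\<alpha> n)"
  shows "\<bar>ln (szego_energy \<alpha> (Suc n) z b) - ln (szego_energy \<alpha> n z b)\<bar> \<le> 64 * cmod (\<alpha> n) / \<kappa>\<^sup>2"
proof -
  define X X' Y Y' where "X = szego_sq \<alpha> n z" and "X' = szego_sq \<alpha> (Suc n) z"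
    and "Y = szego_cross \<alpha> n z" and "Y' = szego_cross \<alpha> (Suc n) z"
  define q where "q = cmod (\<alpha> n) / \<kappa> * X"
  have X: "X > 0" by (simp add: X_def szego_sq_pos[OF z(1)])
  have X': "X' \<ge> \<kappa> / 4 * X" unfolding X_def X'_def by (rule szego_sq_Suc_ge[OF z(1)])
  have "cmod (Y' - Y) \<le> cmod (Y' - z * Y) + cmod ((z - 1) * Y)"
    using norm_triangle_ineq[of "Y' - z * Y" "(z - 1) * Y"] by (simp add: algebra_simps)
  also have "\<dots> \<le> 4 * q + cmod (z - 1) * X"
    using szego_cross_step[OF z(1), of n] norm_szego_cross[OF z(1), of \<alpha> n]
    by (simp add: q_def norm_mult X_def Y_def Y'_def)
  also have "cmod (z - 1) * X \<le> 4 * q"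
  proof -
    have "cmod (z - 1) * X \<le> 4 * cmod (\<alpha> n) * X"
      using X large by (intro mult_right_mono) auto
    also have "\<dots> \<le> 4 * (cmod (\<alpha> n) / \<kappa>) * X"
      using X \<kappa>_pos kappa_le_1 by (intro mult_right_mono) (auto simp: field_simps intro: mult_left_le_one_le)
    finally show ?thesis by (simp add: q_def)
  qed
  finally have Y: "cmod (Y' - Y) \<le> 8 * q" by simp
  have "szego_energy \<alpha> (Suc n) z b - szego_energy \<alpha> n z b = (X' - X) + 2 * Re (z / (z - 1) * b * (Y' - Y))"
    unfolding szego_energy_def X_def X'_def Y_def Y'_def left_diff_distrib right_diff_distrib minus_complex.sel by simp
  also have "\<bar>\<dots>\<bar> \<le> \<bar>X' - X\<bar> + 2 * cmod (z / (z - 1) * b * (Y' - Y))"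
    using abs_Re_le_cmod[of "z / (z - 1) * b * (Y' - Y)"] by linarith
  also have "\<dots> \<le> 4 * q + 2 * (1 / 4 * (8 * q))"
  proof -
    have "cmod (z / (z - 1) * b * (Y' - Y)) = cmod b / cmod (z - 1) * cmod (Y' - Y)"
      using z by (simp add: norm_mult norm_divide)
    also have "\<dots> \<le> 1 / 4 * (8 * q)"
      using Y b z by (intro mult_mono) (auto simp: divide_simps)
    finally show ?thesis
      using szego_sq_step[OF z(1), of n] by (simp add: q_def X_def X'_def)
  qed
  finally have E: "\<bar>szego_energy \<alpha> (Suc n) z b - szego_energy \<alpha> n z b\<bar> \<le> 8 * q" by simp
  \<comment> \<open>The common lower bound \<open>\<kappa> / 8 * X\<close> is half of the lower
    bound for \<open>X'\<close>; it also serves the old form because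
    \<open>\<kappa> \<le> 1\<close>.\<close>
  have "\<bar>ln (szego_energy \<alpha> (Suc n) z b) - ln (szego_energy \<alpha> n z b)\<bar>
      \<le> \<bar>szego_energy \<alpha> (Suc n) z b - szego_energy \<alpha> n z b\<bar> / (\<kappa> / 8 * X)"
  proof (intro abs_ln_diff_le)
    show "0 < \<kappa> / 8 * X" using X \<kappa>_pos by simp
    show "\<kappa> / 8 * X \<le> szego_energy \<alpha> (Suc n) z b"
      using szego_energy_ge[OF z b, of \<alpha> "Suc n"] X' by (simp add: X'_def)
    have "\<kappa> / 8 * X \<le> 1 / 2 * X" using X kappa_le_1 by (intro mult_right_mono) auto
    then show "\<kappa> / 8 * X \<le> szego_energy \<alpha> n z b"
      using szego_energy_ge[OF z b, of \<alpha> n] by (simp add: X_def)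
  qed
  also have "\<dots> \<le> 8 * q / (\<kappa> / 8 * X)"
    using E X \<kappa>_pos by (intro divide_right_mono) auto
  also have "\<dots> = 64 * cmod (\<alpha> n) / \<kappa>\<^sup>2"
    using X \<kappa>_pos by (simp add: q_def field_simps power2_eq_square)
  finally show ?thesis .
qed

text \<open>The increment is split at the new index with the old clipped coefficient. Replacing the
  coefficient costs its variation. The remaining step costs nothing when clipping is inactive, by
  invariance; otherwise \<open>\<epsilon> / 4 < cmod (\<alpha> n)\<close> and the nonelliptic
  estimate applies.\<close>

lemma ln_energy_step:
  assumes z: "cmod z = 1" and \<epsilon>: "0 < \<epsilon>" "\<epsilon> \<le> cmod (z - 1)"
  shows "\<bar>ln_energy \<alpha> (Suc n) z - ln_energy \<alpha> n z\<bar> \<le> step_bound \<alpha> \<kappa> \<epsilon> n"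
proof -
  have z1: "z \<noteq> 1" using \<epsilon> by auto
  let ?b = "clip z (\<alpha> n)"
  have "\<bar>ln_energy \<alpha> (Suc n) z - ln (szego_energy \<alpha> (Suc n) z ?b)\<bar>
     \<le> 4 * cmod (clip z (\<alpha> (Suc n)) - ?b) / cmod (z - 1)"
    unfolding ln_energy_def by (rule ln_szego_energy_diff[OF z z1 clip_le clip_le])
  also have "\<dots> \<le> 4 * cmod (\<alpha> (Suc n) - \<alpha> n) / \<epsilon>"
    using \<epsilon> by (intro frac_le mult_left_mono clip_diff_le) auto
  finally have 1: "\<bar>ln_energy \<alpha> (Suc n) z - ln (szego_energy \<alpha> (Suc n) z ?b)\<bar> \<le> 4 * cmod (\<alpha> (Suc n) - \<alpha> n) / \<epsilon>" .
  have 2: "\<bar>ln (szego_energy \<alpha> (Suc n) z ?b) - ln_energy \<alpha> n z\<bar> \<le>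
      (if \<epsilon> / 4 < cmod (\<alpha> n) then 64 * cmod (\<alpha> n) / \<kappa>\<^sup>2 else 0)"
  proof (cases "cmod (\<alpha> n) \<le> cmod (z - 1) / 4")
    case True
    then show ?thesis
      using szego_energy_Suc[of z \<alpha> n, OF z z1 coeff_less_1] by (simp add: ln_energy_def clip_self)
  next
    case False
    then show ?thesis
      using ln_szego_energy_step[OF z z1 clip_le, of n "\<alpha> n"] \<epsilon> by (simp add: ln_energy_def)
  qed
  from 1 2 show ?thesis unfolding step_bound_def by linarith
qed

text \<open>Both parts compare the clipped coefficient with \<open>0\<close>. The first bound tends
  to zero with \<alpha> and identifies the limits; the second, from the clipping radius, is an
  absolute constant.\<close>

lemma ln_szego_sq_energy:
  assumes z: "cmod z = 1" and \<epsilon>: "0 < \<epsilon>" "\<epsilon> \<le> cmod (z - 1)"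
  shows "\<bar>ln_energy \<alpha> n z - ln (szego_sq \<alpha> n z)\<bar> \<le> 4 * cmod (\<alpha> n) / \<epsilon>"
    and "\<bar>ln_energy \<alpha> n z - ln (szego_sq \<alpha> n z)\<bar> \<le> 1"
proof -
  have z1: "z \<noteq> 1" using \<epsilon> by auto
  have *: "\<bar>ln_energy \<alpha> n z - ln (szego_sq \<alpha> n z)\<bar> \<le> 4 * cmod (clip z (\<alpha> n)) / cmod (z - 1)"
    using ln_szego_energy_diff[OF z z1 clip_le[of z "\<alpha> n"], of 0 n] by (simp add: ln_energy_def szego_energy_def)
  also have "\<dots> \<le> 4 * cmod (\<alpha> n) / \<epsilon>"
    using \<epsilon> by (intro frac_le mult_left_mono clip_le') auto
  finally show "\<bar>ln_energy \<alpha> n z - ln (szego_sq \<alpha> n z)\<bar> \<le> 4 * cmod (\<alpha> n) / \<epsilon>" .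
  have "4 * cmod (clip z (\<alpha> n)) / cmod (z - 1) \<le> 1"
    using clip_le[of z "\<alpha> n"] z1 by (simp add: divide_simps)
  with * show "\<bar>ln_energy \<alpha> n z - ln (szego_sq \<alpha> n z)\<bar> \<le> 1" by linarith
qed

lemma ln_energy_0: "cmod z = 1 \<Longrightarrow> z \<noteq> 1 \<Longrightarrow> \<bar>ln_energy \<alpha> 0 z\<bar> \<le> 1"
  using ln_szego_sq_energy(2)[of z "cmod (z - 1)" 0] by (simp add: szego_sq_def)

section \<open>The locally uniform limit of the logarithms off \<open>1\<close> and its growth near
  \<open>1\<close>\<close>

context
  assumes bv: "summable (\<lambda>n. cmod (\<alpha> (Suc n) - \<alpha> n))" and lim0: "\<alpha> \<longlonglongrightarrow> 0"
begin

text \<open>As \<alpha> tends to zero, \<open>\<epsilon> / 4 < cmod (\<alpha> n)\<close> happens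
  only finitely often; all other terms are multiples of the variation.\<close>

lemma summable_step_bound:
  assumes "\<epsilon> > 0"
  shows "summable (step_bound \<alpha> \<kappa> \<epsilon>)"
proof -
  have "eventually (\<lambda>n. cmod (\<alpha> n) < \<epsilon> / 4) sequentially"
    using tendstoD[OF lim0, of "\<epsilon> / 4"] assms by (simp add: dist_norm)
  then have "eventually (\<lambda>n. step_bound \<alpha> \<kappa> \<epsilon> n = 4 * cmod (\<alpha> (Suc n) - \<alpha> n) / \<epsilon>) sequentially"
    by eventually_elim (simp add: step_bound_def)
  moreover have "summable (\<lambda>n. 4 * cmod (\<alpha> (Suc n) - \<alpha> n) / \<epsilon>)"
    using bv by (intro summable_divide summable_mult)
  ultimately show ?thesis by (subst summable_cong)
qed

lemma step_bound_nonneg: "\<epsilon> > 0 \<Longrightarrow> step_bound \<alpha> \<kappa> \<epsilon> n \<ge> 0"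
  by (simp add: step_bound_def)

lemma uniform_limit_ln_energy:
  assumes "\<epsilon> > 0"
  shows "uniform_limit {z \<in> sphere 0 1. \<epsilon> \<le> cmod (z - 1)} (ln_energy \<alpha>) (ln_limit \<alpha>) sequentially"
proof -
  have "uniform_limit {z \<in> sphere 0 1. \<epsilon> \<le> cmod (z - 1)}
      (\<lambda>n z. \<Sum>i<n. ln_energy \<alpha> (Suc i) z - ln_energy \<alpha> i z)
      (\<lambda>z. \<Sum>i. ln_energy \<alpha> (Suc i) z - ln_energy \<alpha> i z) sequentially"
    using assms by (intro Weierstrass_m_test[OF _ summable_step_bound[OF assms]]) (auto intro!: ln_energy_step)
  then have "uniform_limit {z \<in> sphere 0 1. \<epsilon> \<le> cmod (z - 1)}
      (\<lambda>n z. ln_energy \<alpha> 0 z + (\<Sum>i<n. ln_energy \<alpha> (Suc i) z - ln_energy \<alpha> i z)) (ln_limit \<alpha>) sequentially"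
    unfolding ln_limit_def by (intro uniform_limit_add uniform_limit_const)
  then show ?thesis by (simp add: sum_lessThan_telescope[of "\<lambda>i. ln_energy \<alpha> i _"])
qed

lemma uniform_limit_ln_szego_sq:
  assumes "\<epsilon> > 0"
  shows "uniform_limit {z \<in> sphere 0 1. \<epsilon> \<le> cmod (z - 1)}
    (\<lambda>n z. ln (szego_sq \<alpha> n z)) (ln_limit \<alpha>) sequentially"
proof (rule uniform_limitI)
  fix e :: real assume e: "e > 0"
  have "eventually (\<lambda>n. \<forall>z\<in>{z \<in> sphere 0 1. \<epsilon> \<le> cmod (z - 1)}. dist (ln_energy \<alpha> n z) (ln_limit \<alpha> z) < e / 2) sequentially"
    using uniform_limitD[OF uniform_limit_ln_energy[OF assms], of "e / 2"] e by simp
  moreover have "eventually (\<lambda>n. cmod (\<alpha> n) < e / 2 * \<epsilon> / 4) sequentially"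
    using lim0 assms e unfolding tendsto_iff by (auto simp: dist_norm dest!: spec[of _ "e / 2 * \<epsilon> / 4"])
  ultimately show "eventually (\<lambda>n. \<forall>z\<in>{z \<in> sphere 0 1. \<epsilon> \<le> cmod (z - 1)}. dist (ln (szego_sq \<alpha> n z)) (ln_limit \<alpha> z) < e) sequentially"
  proof eventually_elim
    case (elim n)
    show ?case
    proof
      fix z :: complex assume z: "z \<in> {z \<in> sphere 0 1. \<epsilon> \<le> cmod (z - 1)}"
      have "\<bar>ln_energy \<alpha> n z - ln (szego_sq \<alpha> n z)\<bar> \<le> 4 * cmod (\<alpha> n) / \<epsilon>"
        using z assms by (intro ln_szego_sq_energy) auto
      also have "\<dots> < e / 2" using elim(2) assms by (simp add: field_simps)
      finally show "dist (ln (szego_sq \<alpha> n z)) (ln_limit \<alpha> z) < e"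
        using elim(1) z unfolding dist_real_def by (smt (verit, best) field_sum_of_halves)
    qed
  qed
qed

lemma ln_szego_sq_tendsto:
  assumes "cmod z = 1" "z \<noteq> 1"
  shows "(\<lambda>n. ln (szego_sq \<alpha> n z)) \<longlonglongrightarrow> ln_limit \<alpha> z"
  using assms by (intro tendsto_uniform_limitI[OF uniform_limit_ln_szego_sq[of "cmod (z - 1)"]]) auto

lemma continuous_on_ln_limit: "continuous_on (sphere 0 1 - {1}) (ln_limit \<alpha>)"
proof (subst continuous_on_eq_continuous_within, rule ballI)
  fix z :: complex assume z: "z \<in> sphere 0 1 - {1}"
  \<comment> \<open>Half the distance: \<open>?S\<close> then contains a neighbourhood of z in the
    circle, and continuity on \<open>?S\<close> suffices.\<close>
  define \<epsilon> where "\<epsilon> = cmod (z - 1) / 2"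
  let ?S = "{z \<in> sphere 0 1. \<epsilon> \<le> cmod (z - 1)}"
  have \<epsilon>: "\<epsilon> > 0" using z by (auto simp: \<epsilon>_def)
  have "continuous_on ?S (ln_limit \<alpha>)"
  proof (rule uniform_limit_theorem[OF _ uniform_limit_ln_szego_sq[OF \<epsilon>]])
    have "continuous_on ?S (\<lambda>z. ln (szego_sq \<alpha> n z))" for n
      using szego_sq_pos unfolding szego_sq_def
      by (intro continuous_intros continuous_on_szego) (force simp: less_le)
    then show "\<forall>\<^sub>F n in sequentially. continuous_on ?S (\<lambda>z. ln (szego_sq \<alpha> n z))"
      by simp
  qed simp
  moreover have "z \<in> ?S" using z by (auto simp: \<epsilon>_def)
  ultimately have "continuous (at z within ?S) (ln_limit \<alpha>)"
    by (simp add: continuous_on_eq_continuous_within)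
  moreover have "at z within (sphere 0 1 - {1}) = at z within ?S"
  proof (rule at_within_nhd)
    show "z \<in> - cball 1 \<epsilon>" using z \<epsilon> by (simp add: \<epsilon>_def dist_norm norm_minus_commute)
    show "open (- cball (1 :: complex) \<epsilon>)" by (simp add: open_Compl)
    show "(sphere 0 1 - {1}) \<inter> - cball 1 \<epsilon> - {z} = ?S \<inter> - cball 1 \<epsilon> - {z}"
      using \<epsilon> by (auto simp: dist_norm norm_minus_commute)
  qed
  ultimately show "continuous (at z within sphere 0 1 - {1}) (ln_limit \<alpha>)" by simp
qed

text \<open>The summand 2 is one unit for the initial \<open>ln_energy\<close> and one for passing
  from \<open>ln_energy\<close> back to \<open>szego_sq\<close>.\<close>

lemma ln_szego_sq_bounded:
  assumes \<epsilon>: "\<epsilon> > 0" and z: "cmod z = 1" "\<epsilon> \<le> cmod (z - 1)"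
  shows "\<bar>ln (szego_sq \<alpha> n z)\<bar> \<le> 2 + suminf (step_bound \<alpha> \<kappa> \<epsilon>)"
proof -
  have z1: "z \<noteq> 1" using \<epsilon> z by auto
  have "ln_energy \<alpha> n z = ln_energy \<alpha> 0 z + (\<Sum>i<n. ln_energy \<alpha> (Suc i) z - ln_energy \<alpha> i z)"
    by (simp add: sum_lessThan_telescope[of "\<lambda>i. ln_energy \<alpha> i z"])
  also have "\<bar>\<dots>\<bar> \<le> \<bar>ln_energy \<alpha> 0 z\<bar> + (\<Sum>i<n. \<bar>ln_energy \<alpha> (Suc i) z - ln_energy \<alpha> i z\<bar>)"
    by (rule order_trans[OF abs_triangle_ineq]) (simp add: sum_abs)
  also have "\<dots> \<le> 1 + (\<Sum>i<n. step_bound \<alpha> \<kappa> \<epsilon> i)"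
    using \<epsilon> z z1 by (intro add_mono sum_mono ln_energy_step ln_energy_0)
  also have "(\<Sum>i<n. step_bound \<alpha> \<kappa> \<epsilon> i) \<le> suminf (step_bound \<alpha> \<kappa> \<epsilon>)"
    using step_bound_nonneg[OF \<epsilon>] summable_step_bound[OF \<epsilon>] by (intro sum_le_suminf) auto
  finally show ?thesis using ln_szego_sq_energy(2)[OF z(1) \<epsilon> z(2), of n] by linarith
qed

lemma ln_limit_bound:
  assumes z: "cmod z = 1" "z \<noteq> 1"
  shows "\<bar>ln_limit \<alpha> z\<bar> \<le> 2 + suminf (step_bound \<alpha> \<kappa> (cmod (z - 1)))"
proof (rule tendsto_upperbound)
  show "(\<lambda>n. \<bar>ln (szego_sq \<alpha> n z)\<bar>) \<longlonglongrightarrow> \<bar>ln_limit \<alpha> z\<bar>"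
    by (intro tendsto_rabs ln_szego_sq_tendsto z)
  show "\<forall>\<^sub>F n in sequentially. \<bar>ln (szego_sq \<alpha> n z)\<bar> \<le> 2 + suminf (step_bound \<alpha> \<kappa> (cmod (z - 1)))"
    using z by (intro always_eventually allI ln_szego_sq_bounded) auto
qed simp

lemma ln_limit_power_bound:
  assumes p: "p \<ge> 1" and lp: "summable (\<lambda>n. cmod (\<alpha> n) ^ p)"
  shows "\<exists>C\<ge>0. \<forall>z. cmod z = 1 \<longrightarrow> z \<noteq> 1 \<longrightarrow> \<bar>ln_limit \<alpha> z\<bar> \<le> C / cmod (z - 1) ^ (p - 1)"
proof (cases "p = 1")
  \<comment> \<open>The variation term of \<open>step_bound\<close> would cost a factor
    \<open>1 / cmod (z - 1)\<close> here. The logarithms of \<open>szego_sq\<close> are telescoped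
    directly instead, starting from \<open>ln 1 = 0\<close>.\<close>
  case True
  define C where "C = (\<Sum>n. 16 * cmod (\<alpha> n) / \<kappa>\<^sup>2)"
  have sm: "summable (\<lambda>n. 16 * cmod (\<alpha> n) / \<kappa>\<^sup>2)"
    using lp True by (intro summable_divide summable_mult) simp
  have "\<bar>ln_limit \<alpha> z\<bar> \<le> C" if z: "cmod z = 1" "z \<noteq> 1" for z
  proof (rule tendsto_upperbound)
    show "(\<lambda>n. \<bar>ln (szego_sq \<alpha> n z)\<bar>) \<longlonglongrightarrow> \<bar>ln_limit \<alpha> z\<bar>"
      by (intro tendsto_rabs ln_szego_sq_tendsto z)
    have "\<bar>ln (szego_sq \<alpha> n z)\<bar> \<le> C" for n
    proof -
      have "ln (szego_sq \<alpha> n z) = (\<Sum>i<n. ln (szego_sq \<alpha> (Suc i) z) - ln (szego_sq \<alpha> i z))"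
        by (subst sum_lessThan_telescope[of "\<lambda>i. ln (szego_sq \<alpha> i z)"]) (simp add: szego_sq_def)
      also have "\<bar>\<dots>\<bar> \<le> (\<Sum>i<n. \<bar>ln (szego_sq \<alpha> (Suc i) z) - ln (szego_sq \<alpha> i z)\<bar>)"
        by (rule sum_abs)
      also have "\<dots> \<le> (\<Sum>i<n. 16 * cmod (\<alpha> i) / \<kappa>\<^sup>2)"
        by (intro sum_mono ln_szego_sq_step z)
      also have "\<dots> \<le> C" unfolding C_def by (intro sum_le_suminf sm) auto
      finally show ?thesis .
    qed
    then show "\<forall>\<^sub>F n in sequentially. \<bar>ln (szego_sq \<alpha> n z)\<bar> \<le> C" by simp
  qed simp
  moreover have "C \<ge> 0" unfolding C_def by (intro suminf_nonneg sm) auto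
  ultimately show ?thesis using True by (intro exI[of _ C]) auto
next
  case False
  then obtain q where q: "p = Suc (Suc q)" using p by (metis One_nat_def Suc_le_D not_less_eq_eq old.nat.exhaust)
  define D S where "D = (\<Sum>n. cmod (\<alpha> (Suc n) - \<alpha> n))" and "S = (\<Sum>n. cmod (\<alpha> n) ^ p)"
  \<comment> \<open>Here \<open>Suc q = p - 1\<close>. The powers of 2 raise the constant term and
    the variation term to the order \<open>1 / cmod (z - 1) ^ Suc q\<close>, as
    \<open>cmod (z - 1) \<le> 2\<close>; the power of 4 comes from the threshold
    \<open>e / 4\<close>.\<close>
  define C where "C = 2 * 2 ^ Suc q + 4 * D * 2 ^ q + 64 / \<kappa>\<^sup>2 * 4 ^ Suc q * S"
  have D0: "D \<ge> 0" unfolding D_def by (intro suminf_nonneg bv) auto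
  have S0: "S \<ge> 0" unfolding S_def by (intro suminf_nonneg lp) auto
  have "\<bar>ln_limit \<alpha> z\<bar> \<le> C / cmod (z - 1) ^ Suc q" if z: "cmod z = 1" "z \<noteq> 1" for z
  proof -
    define e where "e = cmod (z - 1)"
    have e: "e > 0" "e \<le> 2" using z norm_triangle_ineq4[of z 1] by (auto simp: e_def)
    have le: "step_bound \<alpha> \<kappa> e n \<le> 4 / e * cmod (\<alpha> (Suc n) - \<alpha> n) + 64 / \<kappa>\<^sup>2 * (4 / e) ^ Suc q * cmod (\<alpha> n) ^ p" for n
    proof -
      have "(if e / 4 < cmod (\<alpha> n) then 64 * cmod (\<alpha> n) / \<kappa>\<^sup>2 else 0)
          \<le> 64 / \<kappa>\<^sup>2 * ((4 / e) ^ Suc q * cmod (\<alpha> n) ^ p)"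
      proof (cases "e / 4 < cmod (\<alpha> n)")
        case True
        then have "1 \<le> 4 / e * cmod (\<alpha> n)" using e by (simp add: field_simps)
        then have "1 \<le> (4 / e * cmod (\<alpha> n)) ^ Suc q" by (rule one_le_power)
        then have "cmod (\<alpha> n) * 1 \<le> cmod (\<alpha> n) * (4 / e * cmod (\<alpha> n)) ^ Suc q"
          by (intro mult_left_mono) auto
        also have "\<dots> = (4 / e) ^ Suc q * cmod (\<alpha> n) ^ p"
          unfolding q power_mult_distrib by (simp only: power_Suc mult_ac)
        finally have "64 / \<kappa>\<^sup>2 * cmod (\<alpha> n) \<le> 64 / \<kappa>\<^sup>2 * ((4 / e) ^ Suc q * cmod (\<alpha> n) ^ p)"
          by (intro mult_left_mono) auto
        then show ?thesis using True by simp
      qed (use e in auto)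
      then show ?thesis by (simp add: step_bound_def mult_ac)
    qed
    have "suminf (step_bound \<alpha> \<kappa> e) \<le> (\<Sum>n. 4 / e * cmod (\<alpha> (Suc n) - \<alpha> n) + 64 / \<kappa>\<^sup>2 * (4 / e) ^ Suc q * cmod (\<alpha> n) ^ p)"
      by (intro suminf_le le summable_step_bound e summable_add summable_mult bv lp)
    also have "\<dots> = 4 / e * D + 64 / \<kappa>\<^sup>2 * (4 / e) ^ Suc q * S"
      unfolding D_def S_def by (intro sums_unique[symmetric] sums_add sums_mult summable_sums bv lp)
    finally have "\<bar>ln_limit \<alpha> z\<bar> \<le> 2 + 4 / e * D + 64 / \<kappa>\<^sup>2 * (4 / e) ^ Suc q * S"
      using ln_limit_bound[OF z] by (simp add: e_def)
    also have "\<dots> \<le> 2 * (2 / e) ^ Suc q + 4 / e * D * (2 / e) ^ q + 64 / \<kappa>\<^sup>2 * (4 / e) ^ Suc q * S"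
    proof -
      have "1 \<le> (2 / e) ^ k" for k using e by (intro one_le_power) (simp add: field_simps)
      then have "2 * 1 \<le> 2 * (2 / e) ^ Suc q" "4 / e * D * 1 \<le> 4 / e * D * (2 / e) ^ q"
        using D0 e by (intro mult_left_mono; simp del: power_Suc)+
      then show ?thesis by linarith
    qed
    also have "\<dots> = C / e ^ Suc q"
      by (simp add: C_def add_divide_distrib power_divide)
    finally show ?thesis by (simp add: e_def)
  qed
  moreover have "C \<ge> 0" using D0 S0 by (simp add: C_def)
  ultimately show ?thesis by (intro exI[of _ C]) (simp add: q del: power_Suc)
qed

lemma borel_measurable_circle_density: "circle_density \<alpha> \<in> borel_measurable borel"
proof -
  have "(\<lambda>z. indicator (sphere 0 1 - {1}) z *\<^sub>R exp (- ln_limit \<alpha> z)) \<in> borel_measurable borel"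
    by (intro borel_measurable_continuous_on_indicator continuous_intros
        continuous_on_ln_limit) auto
  then show ?thesis by (simp add: circle_density_def[abs_def])
qed

text \<open>The uniformity in n supplies the dominating functions for the integrals below.\<close>

lemma ln_limit_bounded:
  assumes "\<epsilon> > 0"
  shows "\<exists>B. \<forall>z. cmod z = 1 \<longrightarrow> \<epsilon> \<le> cmod (z - 1) \<longrightarrow>
    (\<forall>n. \<bar>ln (szego_sq \<alpha> n z)\<bar> \<le> B) \<and> \<bar>ln_limit \<alpha> z\<bar> \<le> B"
proof -
  define B where "B = 2 + suminf (step_bound \<alpha> \<kappa> \<epsilon>)"
  have 1: "\<bar>ln (szego_sq \<alpha> n z)\<bar> \<le> B" if "cmod z = 1" "\<epsilon> \<le> cmod (z - 1)" for n z
    unfolding B_def by (rule ln_szego_sq_bounded[OF assms that])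
  have "\<bar>ln_limit \<alpha> z\<bar> \<le> B" if z: "cmod z = 1" "\<epsilon> \<le> cmod (z - 1)" for z
  proof (rule tendsto_upperbound)
    have "z \<noteq> 1" using z assms by auto
    then show "(\<lambda>n. \<bar>ln (szego_sq \<alpha> n z)\<bar>) \<longlonglongrightarrow> \<bar>ln_limit \<alpha> z\<bar>"
      by (intro tendsto_rabs ln_szego_sq_tendsto z)
    show "\<forall>\<^sub>F n in sequentially. \<bar>ln (szego_sq \<alpha> n z)\<bar> \<le> B" using 1 z by simp
  qed simp
  with 1 show ?thesis by blast
qed

lemma continuous_on_circle_density: "continuous_on {\<theta>. cis \<theta> \<noteq> 1} (\<lambda>\<theta>. circle_density \<alpha> (cis \<theta>))"
proof -
  have "continuous_on {\<theta>. cis \<theta> \<noteq> 1} (\<lambda>\<theta>. exp (- ln_limit \<alpha> (cis \<theta>)))"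
    by (intro continuous_intros continuous_on_compose2[OF continuous_on_ln_limit]) auto
  then show ?thesis by (rule continuous_on_eq) (auto simp: circle_density_def)
qed

text \<open>The distance \<open>cmod (cis \<theta> - 1)\<close> is at least
  \<open>\<bar>sin \<theta>\<bar>\<close>, hence at least \<open>\<bar>\<theta>\<bar> / 2\<close>
  near \<open>0\<close>, because the sine has derivative one there. This turns the rate in
  \<open>cmod (z - 1)\<close> into a rate in \<theta>, with an extra factor
  \<open>2 ^ (p - 1)\<close>.\<close>

lemma ln_circle_density_bigo:
  assumes p: "p \<ge> 1" "in_little_l p \<alpha>"
  shows "(\<lambda>\<theta>. \<bar>ln (circle_density \<alpha> (cis \<theta>))\<bar>) \<in> O[at 0](\<lambda>\<theta>. 1 / \<bar>\<theta>\<bar> ^ (p - 1))"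
proof -
  obtain C where C: "C \<ge> 0" "\<And>z. cmod z = 1 \<Longrightarrow> z \<noteq> 1 \<Longrightarrow> \<bar>ln_limit \<alpha> z\<bar> \<le> C / cmod (z - 1) ^ (p - 1)"
    using ln_limit_power_bound[OF p(1)] p(2) unfolding in_little_l_def by blast
  have "((\<lambda>\<theta>::real. sin \<theta> / \<theta>) \<longlongrightarrow> 1) (at 0)"
    using DERIV_sin[of "0::real"] by (simp add: has_field_derivative_iff)
  then have "eventually (\<lambda>\<theta>::real. sin \<theta> / \<theta> > 1 / 2) (at 0)"
    by (rule order_tendstoD) simp
  then have "eventually (\<lambda>\<theta>. norm \<bar>ln (circle_density \<alpha> (cis \<theta>))\<bar> \<le> (C * 2 ^ (p - 1)) * norm (1 / \<bar>\<theta>\<bar> ^ (p - 1))) (at 0)"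
    using eventually_neq_at_within[of 0]
  proof eventually_elim
    case (elim \<theta>)
    have s: "\<bar>\<theta>\<bar> / 2 \<le> \<bar>sin \<theta>\<bar>"
    proof -
      have "1 / 2 \<le> \<bar>sin \<theta>\<bar> / \<bar>\<theta>\<bar>" using elim(1) abs_ge_self[of "sin \<theta> / \<theta>"] unfolding abs_divide by linarith
      then show ?thesis using elim(2) by (simp add: field_simps)
    qed
    also have "\<bar>sin \<theta>\<bar> \<le> cmod (cis \<theta> - 1)" using abs_Im_le_cmod[of "cis \<theta> - 1"] by simp
    finally have le: "\<bar>\<theta>\<bar> / 2 \<le> cmod (cis \<theta> - 1)" .
    then have ne: "cis \<theta> \<noteq> 1" using elim(2) by auto
    then have "\<bar>ln (circle_density \<alpha> (cis \<theta>))\<bar> = \<bar>ln_limit \<alpha> (cis \<theta>)\<bar>"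
      by (simp add: circle_density_def)
    also have "\<dots> \<le> C / cmod (cis \<theta> - 1) ^ (p - 1)" using C(2) ne by simp
    also have "\<dots> \<le> C / (\<bar>\<theta>\<bar> / 2) ^ (p - 1)"
      using C(1) le elim(2) ne by (intro divide_left_mono power_mono mult_pos_pos zero_less_power) auto
    also have "\<dots> = (C * 2 ^ (p - 1)) * norm (1 / \<bar>\<theta>\<bar> ^ (p - 1))"
      by (simp add: power_divide)
    finally show ?case by simp
  qed
  then show ?thesis by (rule bigoI)
qed

end

end

section \<open>Weak convergence on the circle\<close>

lemma continuous_on_circle_integrable:
  fixes f :: "complex \<Rightarrow> 'b::{banach, second_countable_topology}"
  assumes \<mu>: "circle_prob_measure \<mu>" and f: "continuous_on (sphere 0 1) f"
  shows "f \<in> borel_measurable \<mu>" "integrable \<mu> f"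
proof -
  interpret prob_space \<mu> using \<mu> by (simp add: circle_prob_measure_def)
  have sets: "sets \<mu> = sets circle_borel" using \<mu> by (simp add: circle_prob_measure_def)
  then have space: "space \<mu> = sphere 0 1"
    by (metis sets_eq_imp_space_eq space_restrict_space2 sets_eq_imp_space_eq space_restrict_space space_borel Int_UNIV_right)
  show m: "f \<in> borel_measurable \<mu>"
    using borel_measurable_continuous_on_restrict[OF f] measurable_cong_sets[OF sets refl] by blast
  have "compact (f ` sphere 0 1)" using f compact_continuous_image compact_sphere by blast
  then obtain B where "\<forall>x\<in>sphere 0 1. norm (f x) \<le> B"
    using compact_imp_bounded bounded_iff by (metis imageI)
  then show "integrable \<mu> f"
    using m space by (intro integrable_const_bound[of _ B]) (auto intro!: AE_I2)
qed

lemma circle_prob_measure_space: "circle_prob_measure \<mu> \<Longrightarrow> space \<mu> = sphere 0 1"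
  unfolding circle_prob_measure_def
  by (metis Int_UNIV_right sets_eq_imp_space_eq space_borel space_restrict_space)

lemma prob_space_angle_measure: "prob_space angle_measure"
  unfolding angle_measure_def by (intro prob_space_uniform_measure) auto

lemma measurable_cis: "cis \<in> measurable borel circle_borel"
  by (intro measurable_restrict_space2 borel_measurable_continuous_onI continuous_intros) auto

lemma circle_prob_measure_lebesgue: "circle_prob_measure circle_lebesgue"
proof -
  have "cis \<in> measurable angle_measure circle_borel"
    using measurable_cis by (simp add: angle_measure_def)
  then show ?thesis
    unfolding circle_prob_measure_def circle_lebesgue_def
    using prob_space.prob_space_distr[OF prob_space_angle_measure] by simp
qed

text \<open>The half-open period is replaced by the closed one, which differs by a null point, so
  that the fundamental theorem of calculus becomes applicable.\<close>

lemma integral_circle_lebesgue: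
  fixes f :: "complex \<Rightarrow> complex"
  assumes f: "continuous_on (sphere 0 1) f"
  shows "(LINT z|circle_lebesgue. f z) = (LINT \<theta>|lborel. indicator {0..2 * pi} \<theta> *\<^sub>R f (cis \<theta>)) / (2 * pi)"
proof -
  have m: "f \<in> borel_measurable circle_borel"
    by (rule borel_measurable_continuous_on_restrict[OF f])
  have "(LINT z|circle_lebesgue. f z) = (LINT \<theta>|angle_measure. f (cis \<theta>))"
    unfolding circle_lebesgue_def
    using measurable_cis m by (intro integral_distr) (auto simp: angle_measure_def)
  also have "angle_measure = density lborel (\<lambda>\<theta>. ennreal (indicator {0..<2 * pi} \<theta> / (2 * pi)))"
    unfolding angle_measure_def uniform_measure_def
    by (intro density_cong) (auto simp: indicator_def divide_ennreal[symmetric] ennreal_1)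
  also have "(LINT \<theta>|\<dots>. f (cis \<theta>)) = (LINT \<theta>|lborel. (indicator {0..<2 * pi} \<theta> / (2 * pi)) *\<^sub>R f (cis \<theta>))"
    using measurable_compose[OF measurable_cis m] by (intro integral_density) auto
  also have "\<dots> = (LINT \<theta>|lborel. indicator {0..2 * pi} \<theta> *\<^sub>R f (cis \<theta>) / (2 * pi))"
  proof (intro integral_cong_AE)
    have "AE \<theta> in lborel. \<theta> \<noteq> 2 * pi" by (rule AE_lborel_singleton)
    then show "AE \<theta> in lborel. (indicator {0..<2 * pi} \<theta> / (2 * pi)) *\<^sub>R f (cis \<theta>)
        = indicator {0..2 * pi} \<theta> *\<^sub>R f (cis \<theta>) / (2 * pi)"
      by eventually_elim (auto simp: indicator_def scaleR_conv_of_real)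
  qed (use measurable_compose[OF measurable_cis m] in auto)
  finally show ?thesis by simp
qed

text \<open>For positive k the antiderivative \<open>cis \<theta> ^ k / (\<i> * k)\<close> takes the
  same value at both ends of the period.\<close>

lemma integral_circle_lebesgue_power:
  "(LINT z|circle_lebesgue. z ^ k) = (if k = 0 then 1 else 0)"
proof (cases "k = 0")
  case True
  interpret prob_space circle_lebesgue
    using circle_prob_measure_lebesgue by (simp add: circle_prob_measure_def)
  show ?thesis using True by (simp add: prob_space)
next
  case False
  have "(LINT \<theta>|lborel. indicator {0..2 * pi} \<theta> *\<^sub>R cis \<theta> ^ k)
      = cis (2 * pi) ^ k / (\<i> * k) - cis 0 ^ k / (\<i> * k)"
  proof (rule integral_FTC_Icc)
    fix x :: real
    have e: "cis \<theta> ^ k = exp (\<i> * k * of_real \<theta>)" for \<theta>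
      by (simp only: Complex.DeMoivre) (simp add: cis_conv_exp mult_ac)
    have "((\<lambda>w. exp (\<i> * k * w) / (\<i> * k)) has_field_derivative exp (\<i> * k * of_real x)) (at (of_real x))"
      using False by - (rule derivative_eq_intros refl | simp)+
    from has_vector_derivative_real_field[OF this, of "{0..2 * pi}"]
    show "((\<lambda>\<theta>. cis \<theta> ^ k / (\<i> * k)) has_vector_derivative cis x ^ k) (at x within {0..2 * pi})"
      by (simp only: e)
  qed (auto intro!: continuous_intros)
  then show ?thesis
    using False by (subst integral_circle_lebesgue) (auto intro!: continuous_intros)
qed

text \<open>Since \<open>cnj z ^ k * z ^ k = 1\<close> on the circle, mixed moments reduce to
  moments with nonnegative exponent; as \<open>g\<close> is real, a negative exponent gives a
  conjugate.\<close>

lemma circle_measure_cnj_power: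
  assumes \<mu>: "circle_prob_measure \<mu>"
  shows "(LINT z|\<mu>. cnj z ^ N * z ^ i * complex_of_real (g z)) =
    (if N \<le> i then (LINT z|\<mu>. z ^ (i - N) * complex_of_real (g z))
     else cnj (LINT z|\<mu>. z ^ (N - i) * complex_of_real (g z)))"
proof -
  have red: "cnj z ^ k * z ^ k = 1" if "z \<in> space \<mu>" for z k
    using that circle_prob_measure_space[OF \<mu>] cnj_circle(3)[of z]
    by (simp add: mult.commute flip: power_mult_distrib)
  show ?thesis
  proof (cases "N \<le> i")
    case True
    have "(LINT z|\<mu>. cnj z ^ N * z ^ i * complex_of_real (g z)) = (LINT z|\<mu>. z ^ (i - N) * complex_of_real (g z))"
    proof (intro Bochner_Integration.integral_cong refl)
      fix z assume z: "z \<in> space \<mu>"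
      have "cnj z ^ N * z ^ i = (cnj z ^ N * z ^ N) * z ^ (i - N)"
        using True by (simp add: mult.assoc flip: power_add)
      then show "cnj z ^ N * z ^ i * complex_of_real (g z) = z ^ (i - N) * complex_of_real (g z)"
        using red[OF z] by simp
    qed
    with True show ?thesis by simp
  next
    case False
    have "(LINT z|\<mu>. cnj z ^ N * z ^ i * complex_of_real (g z)) = (LINT z|\<mu>. cnj (z ^ (N - i) * complex_of_real (g z)))"
    proof (intro Bochner_Integration.integral_cong refl)
      fix z assume z: "z \<in> space \<mu>"
      have "cnj z ^ N * z ^ i = (cnj z ^ i * z ^ i) * cnj z ^ (N - i)"
        using False by (simp add: mult_ac flip: power_add)
      then show "cnj z ^ N * z ^ i * complex_of_real (g z) = cnj (z ^ (N - i) * complex_of_real (g z))"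
        using red[OF z] by simp
    qed
    also have "\<dots> = cnj (LINT z|\<mu>. z ^ (N - i) * complex_of_real (g z))" by (rule Bochner_Integration.integral_cnj)
    finally show ?thesis using False by (simp only: if_False)
  qed
qed

text \<open>Real polynomials in the two coordinates restrict to trigonometric polynomials. One power
  of \<open>cnj z\<close> in front collects all negative frequencies, and sums are brought to a
  common such power.\<close>

lemma real_polynomial_function_circle:
  fixes g :: "complex \<Rightarrow> real"
  assumes "real_polynomial_function g"
  shows "\<exists>N q. \<forall>z\<in>sphere 0 1. complex_of_real (g z) = cnj z ^ N * poly q z"
  using assms
proof induction
  case (linear f)
  interpret bounded_linear f by fact
  \<comment> \<open>Re z and Im z are expressed by z and \<open>cnj z\<close>, then one factor
    \<open>cnj z\<close> is taken out, which turns z into \<open>cnj z * z^2\<close>.\<close>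
  define q where "q = [:(f 1 + \<i> * f \<i>) / 2, 0, (f 1 - \<i> * f \<i>) / 2:]"
  have "complex_of_real (f z) = cnj z ^ 1 * poly q z" if "z \<in> sphere 0 1" for z
  proof -
    have z: "cnj z * z = 1" using that cnj_circle(3)[of z] by (simp add: mult.commute)
    have "z = Re z *\<^sub>R 1 + Im z *\<^sub>R \<i>" by (simp add: complex_eq_iff)
    then have "f z = Re z * f 1 + Im z * f \<i>" by (metis add real_scaleR_def scaleR)
    also have "complex_of_real \<dots> = (z + cnj z) / 2 * f 1 + (z - cnj z) / (2 * \<i>) * f \<i>"
      by (simp add: complex_eq_iff)
    also have "\<dots> = cnj z * ((f 1 + \<i> * f \<i>) / 2) + (cnj z * z) * (z * ((f 1 - \<i> * f \<i>) / 2))"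
      unfolding z by (simp add: field_simps)
    also have "\<dots> = cnj z ^ 1 * poly q z" by (simp add: q_def algebra_simps)
    finally show ?thesis .
  qed
  then show ?case by blast
next
  case (const c)
  show ?case by (rule exI[of _ 0], rule exI[of _ "[:complex_of_real c:]"]) simp
next
  case (add f g)
  obtain N q where f: "\<forall>z\<in>sphere 0 1. complex_of_real (f z) = cnj z ^ N * poly q z"
    using add.IH(1) by blast
  obtain M r where g: "\<forall>z\<in>sphere 0 1. complex_of_real (g z) = cnj z ^ M * poly r z"
    using add.IH(2) by blast
  have "complex_of_real (f z + g z) = cnj z ^ (N + M) * poly (monom 1 M * q + monom 1 N * r) z"
    if "z \<in> sphere 0 1" for z
  proof -
    have "cnj z ^ k * z ^ k = 1" for k
      using that cnj_circle(3)[of z] by (simp add: mult.commute flip: power_mult_distrib)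
    then have "cnj z ^ N * poly q z + cnj z ^ M * poly r z =
       (cnj z ^ M * z ^ M) * (cnj z ^ N * poly q z) + (cnj z ^ N * z ^ N) * (cnj z ^ M * poly r z)"
      by simp
    then show ?thesis using f g that by (simp add: poly_monom power_add algebra_simps)
  qed
  then show ?case by blast
next
  case (mult f g)
  obtain N q where f: "\<forall>z\<in>sphere 0 1. complex_of_real (f z) = cnj z ^ N * poly q z"
    using mult.IH(1) by blast
  obtain M r where g: "\<forall>z\<in>sphere 0 1. complex_of_real (g z) = cnj z ^ M * poly r z"
    using mult.IH(2) by blast
  have "complex_of_real (f z * g z) = cnj z ^ (N + M) * poly (q * r) z" if "z \<in> sphere 0 1" for z
    using f g that by (simp add: power_add)
  then show ?case by blast
qed

text \<open>Weierstrass reduces weak convergence on the circle to convergence of the moments.\<close>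

lemma circle_weak_limit:
  fixes X :: "nat \<Rightarrow> complex \<Rightarrow> real" and f :: "complex \<Rightarrow> real"
  assumes \<mu>: "circle_prob_measure \<mu>" and X: "\<And>n. continuous_on (sphere 0 1) (X n)"
    and X_nonneg: "\<And>n z. 0 \<le> X n z"
    and total: "\<And>n. (LINT z|\<mu>. X n z) = 1"
    and moments: "\<And>k. (\<lambda>n. LINT z|\<mu>. z ^ k * complex_of_real (X n z)) \<longlonglongrightarrow> (if k = 0 then 1 else 0)"
    and f: "continuous_on (sphere 0 1) f"
  shows "(\<lambda>n. LINT z|\<mu>. f z * X n z) \<longlonglongrightarrow> (LINT z|circle_lebesgue. f z)"
proof -
  note int = continuous_on_circle_integrable(2)[OF \<mu>] continuous_on_circle_integrable(2)[OF circle_prob_measure_lebesgue]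
  note space = circle_prob_measure_space[OF \<mu>] circle_prob_measure_space[OF circle_prob_measure_lebesgue]
  interpret L: prob_space circle_lebesgue
    using circle_prob_measure_lebesgue by (simp add: circle_prob_measure_def)
  have mom: "(\<lambda>n. LINT z|\<mu>. cnj z ^ N * z ^ i * complex_of_real (X n z))
      \<longlonglongrightarrow> (LINT z|circle_lebesgue. cnj z ^ N * z ^ i)" for N i
  proof -
    have "(LINT z|circle_lebesgue. cnj z ^ N * z ^ i) = (if i = N then 1 else 0)"
      using circle_measure_cnj_power[OF circle_prob_measure_lebesgue, of N i "\<lambda>_. 1"]
      by (simp add: integral_circle_lebesgue_power L.prob_space)
    moreover have "(\<lambda>n. LINT z|\<mu>. cnj z ^ N * z ^ i * complex_of_real (X n z))
        \<longlonglongrightarrow> (if i = N then 1 else 0)"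
    proof (cases "N \<le> i")
      case True
      then have eq: "(\<lambda>n. LINT z|\<mu>. cnj z ^ N * z ^ i * complex_of_real (X n z)) =
          (\<lambda>n. LINT z|\<mu>. z ^ (i - N) * complex_of_real (X n z))"
        by (simp only: circle_measure_cnj_power[OF \<mu>] if_True)
      show ?thesis unfolding eq using moments[of "i - N"] True by (cases "i = N") simp_all
    next
      case False
      then have eq: "(\<lambda>n. LINT z|\<mu>. cnj z ^ N * z ^ i * complex_of_real (X n z)) =
          (\<lambda>n. cnj (LINT z|\<mu>. z ^ (N - i) * complex_of_real (X n z)))"
        by (simp only: circle_measure_cnj_power[OF \<mu>] if_False)
      have "(if N - i = 0 then 1 else 0) = (0::complex)" "i \<noteq> N" using False by auto
      then show ?thesis
        using tendsto_cnj[OF moments[of "N - i"]] unfolding eq by (simp only: if_False complex_cnj_zero)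
    qed
    ultimately show ?thesis by simp
  qed
  have poly: "(\<lambda>n. LINT z|\<mu>. g z * X n z) \<longlonglongrightarrow> (LINT z|circle_lebesgue. g z)"
    if g: "real_polynomial_function g" for g
  proof -
    obtain N q where q: "\<And>z. z \<in> sphere 0 1 \<Longrightarrow> complex_of_real (g z) = cnj z ^ N * poly q z"
      using real_polynomial_function_circle[OF g] by blast
    have "complex_of_real (LINT z|\<mu>. g z * X n z) =
        (\<Sum>i\<le>degree q. coeff q i * (LINT z|\<mu>. cnj z ^ N * z ^ i * complex_of_real (X n z)))" for n
    proof -
      have "complex_of_real (LINT z|\<mu>. g z * X n z) = (LINT z|\<mu>. complex_of_real (g z * X n z))"
        by (rule integral_complex_of_real[symmetric])
      also have "\<dots> = (LINT z|\<mu>. (\<Sum>i\<le>degree q. coeff q i * (cnj z ^ N * z ^ i * complex_of_real (X n z))))"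
      proof (intro Bochner_Integration.integral_cong refl)
        fix z assume "z \<in> space \<mu>"
        then have "complex_of_real (g z * X n z) =
            (cnj z ^ N * (\<Sum>i\<le>degree q. coeff q i * z ^ i)) * complex_of_real (X n z)"
          using q[of z] space by (simp add: poly_altdef)
        also have "\<dots> = (\<Sum>i\<le>degree q. coeff q i * (cnj z ^ N * z ^ i * complex_of_real (X n z)))"
          by (simp only: sum_distrib_left sum_distrib_right mult_ac)
        finally show "complex_of_real (g z * X n z) =
            (\<Sum>i\<le>degree q. coeff q i * (cnj z ^ N * z ^ i * complex_of_real (X n z)))" .
      qed
      also have "\<dots> = (\<Sum>i\<le>degree q. coeff q i * (LINT z|\<mu>. cnj z ^ N * z ^ i * complex_of_real (X n z)))"
        by (subst Bochner_Integration.integral_sum) (auto intro!: int continuous_intros X)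
      finally show ?thesis .
    qed
    moreover have "complex_of_real (LINT z|circle_lebesgue. g z) =
        (\<Sum>i\<le>degree q. coeff q i * (LINT z|circle_lebesgue. cnj z ^ N * z ^ i))"
    proof -
      have "complex_of_real (LINT z|circle_lebesgue. g z) = (LINT z|circle_lebesgue. complex_of_real (g z))"
        by (rule integral_complex_of_real[symmetric])
      also have "\<dots> = (LINT z|circle_lebesgue. (\<Sum>i\<le>degree q. coeff q i * (cnj z ^ N * z ^ i)))"
      proof (intro Bochner_Integration.integral_cong refl)
        fix z assume "z \<in> space circle_lebesgue"
        then have "complex_of_real (g z) = cnj z ^ N * (\<Sum>i\<le>degree q. coeff q i * z ^ i)"
          using q[of z] space by (simp add: poly_altdef)
        also have "\<dots> = (\<Sum>i\<le>degree q. coeff q i * (cnj z ^ N * z ^ i))"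
          by (simp only: sum_distrib_left mult_ac)
        finally show "complex_of_real (g z) = (\<Sum>i\<le>degree q. coeff q i * (cnj z ^ N * z ^ i))" .
      qed
      also have "\<dots> = (\<Sum>i\<le>degree q. coeff q i * (LINT z|circle_lebesgue. cnj z ^ N * z ^ i))"
        by (subst Bochner_Integration.integral_sum) (auto intro!: int continuous_intros)
      finally show ?thesis .
    qed
    ultimately have "(\<lambda>n. complex_of_real (LINT z|\<mu>. g z * X n z)) \<longlonglongrightarrow> complex_of_real (LINT z|circle_lebesgue. g z)"
      by (simp only:) (intro tendsto_intros mom)
    then show ?thesis by (simp only: tendsto_of_real_iff)
  qed
  show ?thesis
  proof (rule LIMSEQ_I)
    fix e :: real assume e: "e > 0"
    obtain g where g: "real_polynomial_function g" and fg: "\<And>x. x \<in> sphere 0 1 \<Longrightarrow> \<bar>f x - g x\<bar> < e / 3"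
      using Stone_Weierstrass_real_polynomial_function[OF compact_sphere f, of "e / 3"] e by auto
    have gc: "continuous_on (sphere 0 1) g"
      by (intro continuous_at_imp_continuous_on ballI continuous_real_polymonial_function g)
    obtain n0 where n0: "\<And>n. n \<ge> n0 \<Longrightarrow> \<bar>(LINT z|\<mu>. g z * X n z) - (LINT z|circle_lebesgue. g z)\<bar> < e / 3"
      using LIMSEQ_D[OF poly[OF g], of "e / 3"] e unfolding real_norm_def by (meson divide_pos_pos zero_less_numeral)
    \<comment> \<open>Total mass one of \<open>X n\<close> against \<mu> makes the approximation
      error independent of n.\<close>
    have 1: "\<bar>(LINT z|\<mu>. f z * X n z) - (LINT z|\<mu>. g z * X n z)\<bar> \<le> e / 3" for n
    proof -
      have "(LINT z|\<mu>. f z * X n z) - (LINT z|\<mu>. g z * X n z) = (LINT z|\<mu>. f z * X n z - g z * X n z)"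
        by (intro Bochner_Integration.integral_diff[symmetric] int continuous_intros f gc X)
      also have "\<bar>\<dots>\<bar> \<le> (LINT z|\<mu>. \<bar>f z * X n z - g z * X n z\<bar>)" by (rule integral_abs_bound)
      also have "\<dots> \<le> (LINT z|\<mu>. e / 3 * X n z)"
      proof (intro integral_mono int continuous_intros f gc X)
        fix z assume "z \<in> space \<mu>"
        then have "\<bar>f z - g z\<bar> * X n z \<le> e / 3 * X n z"
          using fg[of z] space X_nonneg by (intro mult_right_mono) auto
        then show "\<bar>f z * X n z - g z * X n z\<bar> \<le> e / 3 * X n z"
          using X_nonneg[of n z] by (simp add: abs_mult flip: left_diff_distrib)
      qed
      finally show ?thesis using total by simp
    qed
    have 2: "\<bar>(LINT z|circle_lebesgue. g z) - (LINT z|circle_lebesgue. f z)\<bar> \<le> e / 3"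
    proof -
      have "(LINT z|circle_lebesgue. g z) - (LINT z|circle_lebesgue. f z) = (LINT z|circle_lebesgue. g z - f z)"
        by (intro Bochner_Integration.integral_diff[symmetric] int f gc)
      also have "\<bar>\<dots>\<bar> \<le> (LINT z|circle_lebesgue. \<bar>g z - f z\<bar>)" by (rule integral_abs_bound)
      also have "\<dots> \<le> (LINT z|circle_lebesgue. e / 3)"
        using fg space by (intro integral_mono int continuous_intros f gc) (auto simp: abs_minus_commute intro!: less_imp_le)
      finally show ?thesis by (simp add: L.prob_space)
    qed
    show "\<exists>n0. \<forall>n\<ge>n0. norm ((LINT z|\<mu>. f z * X n z) - (LINT z|circle_lebesgue. f z)) < e"
    proof (intro exI allI impI)
      fix n assume "n \<ge> n0"
      then show "norm ((LINT z|\<mu>. f z * X n z) - (LINT z|circle_lebesgue. f z)) < e"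
        using n0[of n] 1[of n] 2 unfolding real_norm_def by linarith
    qed
  qed
qed

section \<open>Orthonormality, and the moments of \<open>szego_sq \<alpha> n\<close> against
  \<mu>\<close>

context
  fixes \<mu> :: "complex measure" and \<alpha> :: "nat \<Rightarrow> complex" and \<kappa> :: real
  assumes \<mu>: "circle_prob_measure \<mu>" and vb: "verblunsky_coefficients \<mu> \<alpha>"
    and \<kappa>_pos: "0 < \<kappa>" and \<kappa>_le: "\<And>n. \<kappa> \<le> 1 - (cmod (\<alpha> n))\<^sup>2"
begin

lemma integrable_poly_product: "integrable \<mu> (\<lambda>z. cnj (poly p z) * poly q z)"
  by (intro continuous_on_circle_integrable(2)[OF \<mu>] continuous_intros)

lemma poly_inner_diff: "poly_inner \<mu> r (p - q) = poly_inner \<mu> r p - poly_inner \<mu> r q"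
  unfolding poly_inner_def using integrable_poly_product[of r p] integrable_poly_product[of r q]
  by (simp add: right_diff_distrib)

lemma poly_inner_smult_right: "poly_inner \<mu> r (smult c p) = c * poly_inner \<mu> r p"
  unfolding poly_inner_def by (simp add: mult.left_commute)

lemma poly_inner_sum: "poly_inner \<mu> r (\<Sum>k\<in>A. p k) = (\<Sum>k\<in>A. poly_inner \<mu> r (p k))"
  unfolding poly_inner_def poly_sum sum_distrib_left
  by (intro Bochner_Integration.integral_sum integrable_poly_product)

lemma poly_inner_cnj: "cnj (poly_inner \<mu> p q) = poly_inner \<mu> q p"
proof -
  have "cnj (poly_inner \<mu> p q) = (LINT z|\<mu>. cnj (cnj (poly p z) * poly q z))"
    unfolding poly_inner_def by (rule Bochner_Integration.integral_cnj[symmetric])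
  then show ?thesis by (simp add: poly_inner_def mult.commute)
qed

lemma poly_inner_smult_left: "poly_inner \<mu> (smult c p) r = cnj c * poly_inner \<mu> p r"
  by (metis poly_inner_cnj poly_inner_smult_right complex_cnj_mult)

lemma poly_inner_self: "poly_inner \<mu> p p = complex_of_real ((poly_norm \<mu> p)\<^sup>2)"
proof -
  have "poly_inner \<mu> p p = (LINT z|\<mu>. complex_of_real ((cmod (poly p z))\<^sup>2))"
    unfolding poly_inner_def complex_norm_square by (simp add: mult.commute)
  also have "\<dots> = complex_of_real (LINT z|\<mu>. (cmod (poly p z))\<^sup>2)" by (rule integral_complex_of_real)
  finally show ?thesis by (simp add: poly_norm_def integral_nonneg_AE)
qed

text \<open>The recursion that defines the coefficients becomes that of \<open>szego\<close> because
  \<open>1 / cnj z = z\<close>; both start at one, as \<mu> has mass one.\<close>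

lemma orthonormal_poly_circle:
  assumes "cmod z = 1"
  shows "poly (orthonormal_poly \<mu> n) z = szego \<alpha> n z"
proof (induction n)
  case 0
  interpret prob_space \<mu> using \<mu> by (simp add: circle_prob_measure_def)
  have "poly_norm \<mu> (monom 1 0) = 1" by (simp add: poly_norm_def poly_monom prob_space)
  then show ?case by (subst orthonormal_poly.simps) (simp add: poly_monom)
next
  case (Suc n)
  have "1 / cnj z = z" "z \<noteq> 0" using cnj_circle[OF assms] by (auto simp: field_simps)
  then show ?case using vb Suc unfolding verblunsky_coefficients_def by (simp add: szego.simps(2))
qed

text \<open>The usual Gram-Schmidt argument by strong induction; the reversed index pairs follow by
  conjugate symmetry.\<close>

lemma orthonormal_poly_inner:
  "poly_inner \<mu> (orthonormal_poly \<mu> j) (orthonormal_poly \<mu> n) = (if j = n then 1 else 0)"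
proof -
  define \<phi> where "\<phi> = orthonormal_poly \<mu>"
  have "\<forall>j\<le>n. poly_inner \<mu> (\<phi> j) (\<phi> n) = (if j = n then 1 else 0)" for n
  proof (induction n rule: less_induct)
    case (less n)
    define P where "P = monom 1 n - (\<Sum>k<n. smult (poly_inner \<mu> (\<phi> k) (monom 1 n)) (\<phi> k))"
    define c where "c = complex_of_real (1 / poly_norm \<mu> P)"
    have \<phi>n: "\<phi> n = smult c P"
      unfolding \<phi>_def c_def P_def by (subst orthonormal_poly.simps) (simp add: Let_def)
    have ortho: "poly_inner \<mu> (\<phi> j) (\<phi> k) = (if j = k then 1 else 0)" if "j < n" "k < n" for j k
    proof (cases "j \<le> k")
      case True
      then show ?thesis using less that by auto
    next
      case False
      then have "poly_inner \<mu> (\<phi> k) (\<phi> j) = 0" using less that by auto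
      then show ?thesis using poly_inner_cnj[of "\<phi> k" "\<phi> j"] False by auto
    qed
    have "poly_inner \<mu> (\<phi> j) P = 0" if "j < n" for j
    proof -
      have "poly_inner \<mu> (\<phi> j) P = poly_inner \<mu> (\<phi> j) (monom 1 n)
          - (\<Sum>k<n. if k = j then poly_inner \<mu> (\<phi> k) (monom 1 n) else 0)"
        unfolding P_def poly_inner_diff poly_inner_sum poly_inner_smult_right
        using ortho[OF that] by (intro arg_cong2[where f = "(-)"] sum.cong) auto
      then show ?thesis using that by simp
    qed
    moreover have "poly_inner \<mu> (\<phi> n) (\<phi> n) = 1"
    proof -
      \<comment> \<open>If \<open>poly_norm \<mu> P\<close> were zero, its reciprocal would be zero
        by convention and \<open>\<phi> n\<close> would be the zero polynomial. The recursion
        excludes this, since it forces \<open>\<phi> n\<close> not to vanish at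
        \<open>1\<close>.\<close>
      have "szego_sq \<alpha> n 1 > 0" by (rule szego_sq_pos[OF \<kappa>_pos \<kappa>_le]) simp
      then have "poly (\<phi> n) 1 \<noteq> 0"
        using orthonormal_poly_circle[of 1 n] by (auto simp: szego_sq_def \<phi>_def)
      then have "poly_norm \<mu> P \<noteq> 0" by (auto simp: \<phi>n c_def)
      then show ?thesis
        unfolding \<phi>n poly_inner_smult_left poly_inner_smult_right poly_inner_self[of P]
        by (simp add: c_def power2_eq_square)
    qed
    ultimately show ?case
      by (auto simp: \<phi>n poly_inner_smult_right le_less)
  qed
  then have *: "poly_inner \<mu> (\<phi> j) (\<phi> n) = (if j = n then 1 else 0)" if "j \<le> n" for j n
    using that by blast
  show ?thesis
  proof (cases "j \<le> n")
    case True
    then show ?thesis using * by (simp add: \<phi>_def)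
  next
    case False
    then show ?thesis using *[of n j] poly_inner_cnj[of "\<phi> n" "\<phi> j"] by (auto simp: \<phi>_def)
  qed
qed

lemma szego_inner: "(LINT z|\<mu>. cnj (szego \<alpha> j z) * szego \<alpha> n z) = (if j = n then 1 else 0)"
proof -
  have "(LINT z|\<mu>. cnj (szego \<alpha> j z) * szego \<alpha> n z) = poly_inner \<mu> (orthonormal_poly \<mu> j) (orthonormal_poly \<mu> n)"
    unfolding poly_inner_def using circle_prob_measure_space[OF \<mu>]
    by (intro Bochner_Integration.integral_cong refl) (simp add: orthonormal_poly_circle)
  then show ?thesis by (simp add: orthonormal_poly_inner)
qed

lemma integral_szego_sq: "(LINT z|\<mu>. szego_sq \<alpha> n z) = 1"
proof -
  have "complex_of_real (LINT z|\<mu>. szego_sq \<alpha> n z) = (LINT z|\<mu>. complex_of_real (szego_sq \<alpha> n z))"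
    by simp
  also have "\<dots> = (LINT z|\<mu>. cnj (szego \<alpha> n z) * szego \<alpha> n z)"
    unfolding szego_sq_def complex_norm_square by (simp add: mult.commute)
  also have "\<dots> = complex_of_real 1" by (simp add: szego_inner)
  finally show ?thesis by (simp only: of_real_eq_iff)
qed

text \<open>Telescoping in k; multiplication by z preserves moduli. A single step leaves the cross
  term of the recursion and a multiple of \<open>\<rho> - 1\<close>, where \<open>\<rho>\<close> is
  the square root in the recursion, and \<open>1 - \<rho>\<close> is at most the modulus of the
  coefficient.\<close>

lemma szego_shift_error:
  assumes z: "cmod z = 1"
  shows "cmod (z ^ k * szego \<alpha> n z - szego \<alpha> (n + k) z)
    \<le> (\<Sum>j<k. cmod (\<alpha> (n + j)) * (cmod (szego \<alpha> (n + j) z) + cmod (szego \<alpha> (Suc (n + j)) z)))"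
proof (induction k)
  case (Suc k)
  define m where "m = n + k"
  define \<rho> where "\<rho> = sqrt (1 - (cmod (\<alpha> m))\<^sup>2)"
  have a: "0 \<le> cmod (\<alpha> m)" "cmod (\<alpha> m) < 1" using coeff_less_1[OF \<kappa>_pos \<kappa>_le] by auto
  then have "(cmod (\<alpha> m))\<^sup>2 < 1" by (simp add: abs_square_less_1)
  then have \<rho>: "\<rho> > 0" "\<rho> \<le> 1" by (auto simp: \<rho>_def)
  have "1 - cmod (\<alpha> m) \<le> \<rho>"
  proof -
    have "(cmod (\<alpha> m))\<^sup>2 \<le> cmod (\<alpha> m)" using a by (simp add: power2_eq_square mult_left_le)
    then have "(1 - cmod (\<alpha> m))\<^sup>2 \<le> 1 - (cmod (\<alpha> m))\<^sup>2" by (simp add: power2_eq_square algebra_simps)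
    then show ?thesis unfolding \<rho>_def by (rule real_le_rsqrt)
  qed
  moreover have "cmod (of_real \<rho> - 1) = \<bar>\<rho> - 1\<bar>"
    by (metis norm_of_real of_real_1 of_real_diff)
  ultimately have \<rho>1: "cmod (of_real \<rho> - 1) \<le> cmod (\<alpha> m)"
    using \<rho> by simp
  have "szego \<alpha> (Suc m) z = (z * szego \<alpha> m z - cnj (\<alpha> m) * z ^ m * cnj (szego \<alpha> m z)) / of_real \<rho>"
    unfolding \<rho>_def by (rule szego.simps(2))
  then have "of_real \<rho> * szego \<alpha> (Suc m) z = z * szego \<alpha> m z - cnj (\<alpha> m) * z ^ m * cnj (szego \<alpha> m z)"
    using \<rho> by (simp)
  then have "z * szego \<alpha> m z - szego \<alpha> (Suc m) z =
      (of_real \<rho> - 1) * szego \<alpha> (Suc m) z + cnj (\<alpha> m) * z ^ m * cnj (szego \<alpha> m z)"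
    by (simp add: algebra_simps)
  also have "cmod \<dots> \<le> cmod (of_real \<rho> - 1) * cmod (szego \<alpha> (Suc m) z) + cmod (\<alpha> m) * cmod (szego \<alpha> m z)"
    by (rule order_trans[OF norm_triangle_ineq]) (simp add: norm_mult norm_power z)
  also have "\<dots> \<le> cmod (\<alpha> m) * cmod (szego \<alpha> (Suc m) z) + cmod (\<alpha> m) * cmod (szego \<alpha> m z)"
    using \<rho>1 by (intro add_mono mult_right_mono) auto
  finally have step: "cmod (z * szego \<alpha> m z - szego \<alpha> (Suc m) z)
      \<le> cmod (\<alpha> m) * (cmod (szego \<alpha> m z) + cmod (szego \<alpha> (Suc m) z))"
    by (simp only: distrib_left add.commute)
  have "z ^ Suc k * szego \<alpha> n z - szego \<alpha> (n + Suc k) z =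
      z * (z ^ k * szego \<alpha> n z - szego \<alpha> m z) + (z * szego \<alpha> m z - szego \<alpha> (Suc m) z)"
    unfolding m_def add_Suc_right by (simp only: power_Suc right_diff_distrib mult.assoc diff_add_cancel) simp
  also have "cmod \<dots> \<le> cmod (z ^ k * szego \<alpha> n z - szego \<alpha> m z) + cmod (z * szego \<alpha> m z - szego \<alpha> (Suc m) z)"
    by (rule order_trans[OF norm_triangle_ineq]) (simp add: norm_mult z)
  finally show ?case using Suc step unfolding m_def by simp
qed simp

text \<open>The moment is the inner product of \<open>szego \<alpha> n\<close> with
  \<open>z ^ k * szego \<alpha> n\<close>, which is \<open>szego \<alpha> (n + k)\<close> up to the
  shift error. Orthonormality evaluates the main term, and the error is bounded by k late
  coefficients.\<close>

lemma szego_moments: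
  assumes lim0: "\<alpha> \<longlonglongrightarrow> 0"
  shows "(\<lambda>n. LINT z|\<mu>. z ^ k * complex_of_real (szego_sq \<alpha> n z)) \<longlonglongrightarrow> (if k = 0 then 1 else 0)"
proof -
  note int = continuous_on_circle_integrable(2)[OF \<mu>]
  have bound: "cmod ((LINT z|\<mu>. z ^ k * complex_of_real (szego_sq \<alpha> n z)) - (if k = 0 then 1 else 0))
      \<le> (\<Sum>j<k. 2 * cmod (\<alpha> (n + j)))" for n
  proof -
    define E where "E z = z ^ k * szego \<alpha> n z - szego \<alpha> (n + k) z" for z
    have E: "continuous_on (sphere 0 1) E" unfolding E_def by (intro continuous_intros continuous_on_szego)
    have "(LINT z|\<mu>. z ^ k * complex_of_real (szego_sq \<alpha> n z)) =
        (LINT z|\<mu>. cnj (szego \<alpha> n z) * szego \<alpha> (n + k) z + cnj (szego \<alpha> n z) * E z)"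
      unfolding szego_sq_def complex_norm_square E_def
      by (intro Bochner_Integration.integral_cong refl) (simp add: algebra_simps)
    also have "\<dots> = (LINT z|\<mu>. cnj (szego \<alpha> n z) * szego \<alpha> (n + k) z) + (LINT z|\<mu>. cnj (szego \<alpha> n z) * E z)"
      by (intro Bochner_Integration.integral_add int continuous_intros continuous_on_szego E)
    finally have "(LINT z|\<mu>. z ^ k * complex_of_real (szego_sq \<alpha> n z)) - (if k = 0 then 1 else 0) =
        (LINT z|\<mu>. cnj (szego \<alpha> n z) * E z)"
      by (simp add: szego_inner)
    also have "cmod \<dots> \<le> (LINT z|\<mu>. cmod (cnj (szego \<alpha> n z) * E z))" by (rule integral_norm_bound)
    also have "\<dots> \<le> (LINT z|\<mu>. (\<Sum>j<k. cmod (\<alpha> (n + j)) *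
        (szego_sq \<alpha> n z + (szego_sq \<alpha> (n + j) z + szego_sq \<alpha> (Suc (n + j)) z) / 2)))"
    proof (intro integral_mono int continuous_intros continuous_on_szego continuous_on_szego_sq E)
      fix z assume "z \<in> space \<mu>"
      then have z: "cmod z = 1" using circle_prob_measure_space[OF \<mu>] by simp
      define x where "x m = cmod (szego \<alpha> m z)" for m
      \<comment> \<open>Products of moduli become sums of squares, each of which has integral
        one.\<close>
      have amgm: "x n * x m \<le> ((x n)\<^sup>2 + (x m)\<^sup>2) / 2" for m
        using zero_le_power2[of "x n - x m"] by (simp add: power2_eq_square algebra_simps)
      have "cmod (cnj (szego \<alpha> n z) * E z) \<le> x n * (\<Sum>j<k. cmod (\<alpha> (n + j)) * (x (n + j) + x (Suc (n + j))))"
        using szego_shift_error[OF z, of k n] unfolding E_def x_def norm_mult complex_mod_cnj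
        by (intro mult_left_mono) auto
      also have "\<dots> = (\<Sum>j<k. cmod (\<alpha> (n + j)) * (x n * x (n + j) + x n * x (Suc (n + j))))"
        by (simp only: sum_distrib_left distrib_left mult.left_commute)
      also have "\<dots> \<le> (\<Sum>j<k. cmod (\<alpha> (n + j)) * ((x n)\<^sup>2 + ((x (n + j))\<^sup>2 + (x (Suc (n + j)))\<^sup>2) / 2))"
      proof (intro sum_mono mult_left_mono norm_ge_zero)
        fix j
        show "x n * x (n + j) + x n * x (Suc (n + j)) \<le> (x n)\<^sup>2 + ((x (n + j))\<^sup>2 + (x (Suc (n + j)))\<^sup>2) / 2"
          using amgm[of "n + j"] amgm[of "Suc (n + j)"] by (simp add: field_simps)
      qed
      finally show "cmod (cnj (szego \<alpha> n z) * E z) \<le> (\<Sum>j<k. cmod (\<alpha> (n + j)) *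
        (szego_sq \<alpha> n z + (szego_sq \<alpha> (n + j) z + szego_sq \<alpha> (Suc (n + j)) z) / 2))"
        by (simp only: szego_sq_def x_def)
    qed auto
    also have "\<dots> = (\<Sum>j<k. cmod (\<alpha> (n + j)) *
        ((LINT z|\<mu>. szego_sq \<alpha> n z) + ((LINT z|\<mu>. szego_sq \<alpha> (n + j) z) + (LINT z|\<mu>. szego_sq \<alpha> (Suc (n + j)) z)) / 2))"
    proof -
      have i: "integrable \<mu> (szego_sq \<alpha> m)" for m by (intro int continuous_on_szego_sq)
      show ?thesis
        using i by (subst Bochner_Integration.integral_sum) auto
    qed
    also have "\<dots> = (\<Sum>j<k. 2 * cmod (\<alpha> (n + j)))" by (simp add: integral_szego_sq mult.commute)
    finally show ?thesis .
  qed
  have "(\<lambda>n. \<Sum>j<k. 2 * cmod (\<alpha> (n + j))) \<longlonglongrightarrow> (\<Sum>j<k. 2 * cmod 0)"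
    by (intro tendsto_intros LIMSEQ_ignore_initial_segment lim0)
  then have "(\<lambda>n. \<Sum>j<k. 2 * cmod (\<alpha> (n + j))) \<longlonglongrightarrow> 0" by simp
  then have "(\<lambda>n. (LINT z|\<mu>. z ^ k * complex_of_real (szego_sq \<alpha> n z)) - (if k = 0 then 1 else 0)) \<longlonglongrightarrow> 0"
    by (rule Lim_null_comparison[rotated]) (use bound in auto)
  then show ?thesis by (simp add: LIM_zero_iff)
qed

end

section \<open>The Lebesgue decomposition\<close>

lemma in_little_l_tendsto_0:
  assumes "p \<ge> 1" "in_little_l p a"
  shows "a \<longlonglongrightarrow> 0"
proof -
  have "(\<lambda>n. cmod (a n) ^ p) \<longlonglongrightarrow> 0"
    using assms(2) unfolding in_little_l_def by (rule summable_LIMSEQ_zero)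
  then have "(\<lambda>n. root p (cmod (a n) ^ p)) \<longlonglongrightarrow> root p 0"
    by (rule tendsto_real_root)
  then have "(\<lambda>n. cmod (a n)) \<longlonglongrightarrow> 0"
    using assms(1) by (simp add: real_root_power_cancel)
  then show ?thesis by (rule tendsto_norm_zero_cancel)
qed

lemma coeff_bounded_away:
  fixes \<alpha> :: "nat \<Rightarrow> complex"
  assumes "\<And>n. cmod (\<alpha> n) < 1" "\<alpha> \<longlonglongrightarrow> 0"
  obtains \<kappa> where "\<kappa> > 0" "\<And>n. \<kappa> \<le> 1 - (cmod (\<alpha> n))\<^sup>2"
proof -
  have "(\<lambda>n. 1 - (cmod (\<alpha> n))\<^sup>2) \<longlonglongrightarrow> 1 - (cmod 0)\<^sup>2"
    by (intro tendsto_intros assms)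
  then have "eventually (\<lambda>n. 1 - (cmod (\<alpha> n))\<^sup>2 > 1 / 2) sequentially"
    by (rule order_tendstoD) simp
  then obtain N where N: "\<And>n. n \<ge> N \<Longrightarrow> 1 - (cmod (\<alpha> n))\<^sup>2 > 1 / 2"
    by (auto simp: eventually_sequentially)
  define \<kappa> where "\<kappa> = Min (insert (1 / 2) ((\<lambda>n. 1 - (cmod (\<alpha> n))\<^sup>2) ` {..<N}))"
  have "\<kappa> > 0" using assms(1) by (auto simp: \<kappa>_def abs_square_less_1)
  moreover have "\<kappa> \<le> 1 - (cmod (\<alpha> n))\<^sup>2" for n
  proof (cases "n < N")
    case True
    then show ?thesis unfolding \<kappa>_def by (intro Min_le) auto
  next
    case False
    have "\<kappa> \<le> 1 / 2" unfolding \<kappa>_def by (intro Min_le) auto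
    then show ?thesis using N[of n] False by simp
  qed
  ultimately show ?thesis using that by blast
qed

text \<open>\<open>Arg2pi\<close> is continuous off the nonnegative reals and zero on them. It
  serves to turn Borel sets of angles into Borel sets of the circle.\<close>

lemma borel_measurable_Arg2pi: "Arg2pi \<in> borel_measurable borel"
proof -
  have "(\<lambda>z. if z \<in> \<real>\<^sub>\<ge>\<^sub>0 then 0 else Arg2pi z) \<in> borel_measurable borel"
    by (intro borel_measurable_continuous_on_if borel_closed closed_nonneg_Reals_complex continuous_on_const
        continuous_at_imp_continuous_on ballI continuous_at_Arg2pi) auto
  also have "(\<lambda>z. if z \<in> \<real>\<^sub>\<ge>\<^sub>0 then 0 else Arg2pi z) = Arg2pi"
    by (auto simp: fun_eq_iff complex_nonneg_Reals_iff Arg2pi_eq_0 complex_is_Real_iff)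
  finally show ?thesis .
qed

lemma Arg2pi_cis: "0 \<le> \<theta> \<Longrightarrow> \<theta> < 2 * pi \<Longrightarrow> Arg2pi (cis \<theta>) = \<theta>"
  by (rule Arg2pi_unique[of 1]) (auto simp: cis_conv_exp)

lemma AE_angle_measure: "(AE \<theta> in angle_measure. P \<theta>) \<longleftrightarrow> (AE \<theta> in lborel. \<theta> \<in> {0..<2 * pi} \<longrightarrow> P \<theta>)"
  unfolding angle_measure_def by (rule AE_uniform_measure) auto

lemma sets_circle_borel_iff: "A \<in> sets circle_borel \<longleftrightarrow> A \<in> sets borel \<and> A \<subseteq> sphere 0 1"
  using sets_restrict_space_iff[of "sphere 0 1 :: complex set" borel A] by auto

lemma nn_integral_circle_lebesgue:
  assumes "f \<in> borel_measurable circle_borel"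
  shows "(\<integral>\<^sup>+z. f z \<partial>circle_lebesgue) = (\<integral>\<^sup>+\<theta>. f (cis \<theta>) \<partial>angle_measure)"
  unfolding circle_lebesgue_def using measurable_cis assms
  by (intro nn_integral_distr) (auto simp: angle_measure_def)

text \<open>Countably many translates of one period cover the line, and Lebesgue measure is
  translation invariant, so the exceptional sets of all translates together are null.\<close>

lemma AE_periodic:
  fixes f g :: "real \<Rightarrow> real"
  assumes [measurable]: "f \<in> borel_measurable borel" "g \<in> borel_measurable borel"
    and per: "\<And>\<theta>. f (\<theta> + 2 * pi) = f \<theta>" "\<And>\<theta>. g (\<theta> + 2 * pi) = g \<theta>"
    and AE: "AE \<theta> in angle_measure. f \<theta> = g \<theta>"
  shows "AE \<theta> in lborel. f \<theta> = g \<theta>"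
proof -
  have shift: "f (\<theta> + of_int k * (2 * pi)) = f \<theta>" "g (\<theta> + of_int k * (2 * pi)) = g \<theta>" for \<theta> k
  proof -
    interpret f: periodic_fun_simple f "2 * pi" by standard (rule per)
    interpret g: periodic_fun_simple g "2 * pi" by standard (rule per)
    show "f (\<theta> + of_int k * (2 * pi)) = f \<theta>" "g (\<theta> + of_int k * (2 * pi)) = g \<theta>"
      using f.plus_of_int[of \<theta> k] g.plus_of_int[of \<theta> k] by auto
  qed
  have "AE \<theta> in lborel. \<forall>k::int. of_int k * (2 * pi) + \<theta> \<in> {0..<2 * pi} \<longrightarrow>
      f (of_int k * (2 * pi) + \<theta>) = g (of_int k * (2 * pi) + \<theta>)"
  proof (subst AE_all_countable, intro allI)
    fix k :: int
    have "AE \<theta> in distr lborel borel ((+) (of_int k * (2 * pi))). \<theta> \<in> {0..<2 * pi} \<longrightarrow> f \<theta> = g \<theta>"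
      unfolding lborel_distr_plus using AE unfolding AE_angle_measure .
    then show "AE \<theta> in lborel. of_int k * (2 * pi) + \<theta> \<in> {0..<2 * pi} \<longrightarrow>
      f (of_int k * (2 * pi) + \<theta>) = g (of_int k * (2 * pi) + \<theta>)"
      by (subst (asm) AE_distr_iff) auto
  qed
  then show ?thesis
  proof eventually_elim
    case (elim \<theta>)
    define k where "k = - \<lfloor>\<theta> / (2 * pi)\<rfloor>"
    have "of_int k * (2 * pi) + \<theta> = frac (\<theta> / (2 * pi)) * (2 * pi)"
      by (simp add: k_def frac_def field_simps)
    also have "\<dots> \<in> {0..<2 * pi}" using frac_ge_0 frac_lt_1[of "\<theta> / (2 * pi)"] by simp
    finally have "f (of_int k * (2 * pi) + \<theta>) = g (of_int k * (2 * pi) + \<theta>)" using elim by blast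
    then show ?case using shift[of \<theta> k] by (simp add: add.commute)
  qed
qed

section \<open>Identification of \<mu> away from the point \<open>1\<close>\<close>

context
  fixes \<mu> :: "complex measure" and \<alpha> :: "nat \<Rightarrow> complex" and \<kappa> :: real
  assumes \<mu>: "circle_prob_measure \<mu>" and vb: "verblunsky_coefficients \<mu> \<alpha>"
    and \<kappa>_pos: "0 < \<kappa>" and \<kappa>_le: "\<And>n. \<kappa> \<le> 1 - (cmod (\<alpha> n))\<^sup>2"
    and bv: "summable (\<lambda>n. cmod (\<alpha> (Suc n) - \<alpha> n))" and lim0: "\<alpha> \<longlonglongrightarrow> 0"
begin

text \<open>Weak convergence is tested on \<open>g = f * exp (- ln_limit)\<close>, which is
  continuous since \<open>f\<close> vanishes near \<open>1\<close>. But \<open>g * szego_sq\<close>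
  also tends to \<open>f\<close> pointwise with a dominating function, so the same integrals
  converge to the integral of \<open>f\<close> against \<mu>.\<close>

lemma integral_eq_circle_density:
  fixes f :: "complex \<Rightarrow> real"
  assumes \<epsilon>: "\<epsilon> > 0" and f: "continuous_on (sphere 0 1) f"
    and f0: "\<And>z. cmod z = 1 \<Longrightarrow> cmod (z - 1) < \<epsilon> \<Longrightarrow> f z = 0"
  shows "(LINT z|\<mu>. f z) = (LINT z|circle_lebesgue. f z * circle_density \<alpha> z)"
proof -
  note space = circle_prob_measure_space[OF \<mu>] circle_prob_measure_space[OF circle_prob_measure_lebesgue]
  interpret prob_space \<mu> using \<mu> by (simp add: circle_prob_measure_def)
  define g where "g z = f z * circle_density \<alpha> z" for z
  have g_eq: "g z = f z * exp (- ln_limit \<alpha> z)" if "cmod z = 1" for z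
    using f0[of z] that \<epsilon> by (cases "z = 1") (auto simp: g_def circle_density_def)
  have g: "continuous_on (sphere 0 1) g"
  proof -
    \<comment> \<open>Two closed pieces: on the first \<open>ln_limit\<close> is continuous, on the
      second \<open>g\<close> is zero.\<close>
    have "continuous_on (sphere 0 1 \<inter> - ball 1 (\<epsilon> / 2) \<union> sphere 0 1 \<inter> cball 1 (\<epsilon> / 2)) g"
    proof (rule continuous_on_closed_Un)
      have "continuous_on (sphere 0 1 \<inter> - ball 1 (\<epsilon> / 2)) (\<lambda>z. f z * exp (- ln_limit \<alpha> z))"
        using \<epsilon> by (intro continuous_intros continuous_on_subset[OF f]
          continuous_on_subset[OF continuous_on_ln_limit[OF \<kappa>_pos \<kappa>_le bv lim0]]) auto
      then show "continuous_on (sphere 0 1 \<inter> - ball 1 (\<epsilon> / 2)) g"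
        by (rule continuous_on_eq) (simp add: g_eq)
      have "continuous_on (sphere 0 1 \<inter> cball 1 (\<epsilon> / 2)) (\<lambda>z::complex. 0::real)" by simp
      then show "continuous_on (sphere 0 1 \<inter> cball 1 (\<epsilon> / 2)) g"
        using \<epsilon> by (rule_tac continuous_on_eq) (auto simp: g_def f0 dist_norm norm_minus_commute)
    qed (auto intro!: closed_Int closed_Compl)
    moreover have "sphere 0 1 \<inter> - ball 1 (\<epsilon> / 2) \<union> sphere 0 1 \<inter> cball 1 (\<epsilon> / 2) = sphere (0::complex) 1"
      by auto
    ultimately show ?thesis by simp
  qed
  have "(\<lambda>n. LINT z|\<mu>. g z * szego_sq \<alpha> n z) \<longlonglongrightarrow> (LINT z|circle_lebesgue. g z)"
    by (intro circle_weak_limit[OF \<mu>] continuous_on_szego_sq g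
        integral_szego_sq[OF \<mu> vb \<kappa>_pos \<kappa>_le] szego_moments[OF \<mu> vb \<kappa>_pos \<kappa>_le lim0])
      (simp add: szego_sq_def)
  moreover have "(\<lambda>n. LINT z|\<mu>. g z * szego_sq \<alpha> n z) \<longlonglongrightarrow> (LINT z|\<mu>. f z)"
  proof -
    obtain B where B: "\<And>n z. cmod z = 1 \<Longrightarrow> \<epsilon> \<le> cmod (z - 1) \<Longrightarrow> \<bar>ln (szego_sq \<alpha> n z)\<bar> \<le> B"
      using ln_limit_bounded[OF \<kappa>_pos \<kappa>_le bv lim0 \<epsilon>] by blast
    show ?thesis
    proof (rule integral_dominated_convergence[where w = "\<lambda>z. \<bar>g z\<bar> * exp B"])
      show "f \<in> borel_measurable \<mu>" by (rule continuous_on_circle_integrable(1)[OF \<mu> f])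
      show "(\<lambda>z. g z * szego_sq \<alpha> n z) \<in> borel_measurable \<mu>" for n
        by (intro continuous_on_circle_integrable(1)[OF \<mu>] continuous_intros g continuous_on_szego_sq)
      show "integrable \<mu> (\<lambda>z. \<bar>g z\<bar> * exp B)"
        by (intro continuous_on_circle_integrable(2)[OF \<mu>] continuous_intros g)
      show "AE z in \<mu>. (\<lambda>n. g z * szego_sq \<alpha> n z) \<longlonglongrightarrow> f z"
      proof (rule AE_I2)
        fix z assume "z \<in> space \<mu>"
        then have z: "cmod z = 1" using space by simp
        show "(\<lambda>n. g z * szego_sq \<alpha> n z) \<longlonglongrightarrow> f z"
        proof (cases "z = 1")
          case True
          then show ?thesis using f0[of 1] \<epsilon> by (simp add: g_def)
        next
          case False
          have "(\<lambda>n. g z * exp (ln (szego_sq \<alpha> n z))) \<longlonglongrightarrow> g z * exp (ln_limit \<alpha> z)"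
            by (intro tendsto_intros ln_szego_sq_tendsto[OF \<kappa>_pos \<kappa>_le bv lim0] z False)
          moreover have "g z * exp (ln_limit \<alpha> z) = f z"
            by (simp add: g_eq z mult.assoc flip: exp_add)
          moreover have "exp (ln (szego_sq \<alpha> n z)) = szego_sq \<alpha> n z" for n
            by (rule exp_ln[OF szego_sq_pos[OF \<kappa>_pos \<kappa>_le z]])
          ultimately show ?thesis by simp
        qed
      qed
      show "AE z in \<mu>. norm (g z * szego_sq \<alpha> n z) \<le> \<bar>g z\<bar> * exp B" for n
      proof (rule AE_I2)
        fix z assume "z \<in> space \<mu>"
        then have z: "cmod z = 1" using space by simp
        show "norm (g z * szego_sq \<alpha> n z) \<le> \<bar>g z\<bar> * exp B"
        proof (cases "cmod (z - 1) < \<epsilon>")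
          case True
          then show ?thesis using f0 z by (simp add: g_def)
        next
          case False
          have pos: "szego_sq \<alpha> n z > 0" by (rule szego_sq_pos[OF \<kappa>_pos \<kappa>_le z])
          have "ln (szego_sq \<alpha> n z) \<le> B" using B[OF z, of n] False by simp
          then have "szego_sq \<alpha> n z \<le> exp B" using pos by (metis exp_ln exp_le_cancel_iff)
          then show ?thesis using pos by (simp add: abs_mult mult_left_mono)
        qed
      qed
    qed
  qed
  ultimately have "(LINT z|circle_lebesgue. g z) = (LINT z|\<mu>. f z)" by (rule LIMSEQ_unique)
  then show ?thesis by (simp add: g_def)
qed

text \<open>The indicator of \<open>K\<close> is a pointwise limit of continuous cutoffs vanishing
  near \<open>1\<close>, for which the integrals are known to agree. Dominated convergence is
  applied on both sides.\<close>

lemma measure_closed_eq_circle_density: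
  assumes \<epsilon>: "\<epsilon> > 0" and K: "closed K" "\<And>z. z \<in> K \<Longrightarrow> \<epsilon> \<le> cmod (z - 1)"
  shows "emeasure \<mu> (K \<inter> sphere 0 1) = (\<integral>\<^sup>+z. ennreal (indicator K z * circle_density \<alpha> z) \<partial>circle_lebesgue)"
\<comment> \<open>\<open>infdist\<close> to the empty set is zero by convention, so the cutoffs
  would fail for it.\<close>
proof (cases "K = {}")
  case False
  note space = circle_prob_measure_space[OF \<mu>] circle_prob_measure_space[OF circle_prob_measure_lebesgue]
  interpret prob_space \<mu> using \<mu> by (simp add: circle_prob_measure_def)
  interpret L: prob_space circle_lebesgue
    using circle_prob_measure_lebesgue by (simp add: circle_prob_measure_def)
  have sets: "sets \<mu> = sets circle_borel" using \<mu> by (simp add: circle_prob_measure_def)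
  have setsL: "sets circle_lebesgue = sets circle_borel" by (simp add: circle_lebesgue_def)
  \<comment> \<open>At least \<open>2 / \<epsilon>\<close>, so that every cutoff is zero from
    distance \<open>\<epsilon> / 2\<close> to \<open>K\<close> onwards.\<close>
  define M where "M = nat \<lceil>2 / \<epsilon>\<rceil>"
  define f where "f m z = max 0 (1 - real (m + M) * infdist z K)" for m z
  have f_cont: "continuous_on S (f m)" for m S
    unfolding f_def by (intro continuous_intros)
  have f_bd: "0 \<le> f m z" "f m z \<le> 1" for m z
    by (auto simp: f_def infdist_nonneg)
  have f0: "f m z = 0" if z: "cmod (z - 1) < \<epsilon> / 2" for m z
  proof -
    have "\<epsilon> / 2 \<le> dist z a" if "a \<in> K" for a
      using K(2)[OF that] z norm_triangle_ineq[of "a - z" "z - 1"] by (simp add: dist_norm norm_minus_commute)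
    then have "\<epsilon> / 2 \<le> infdist z K"
      unfolding infdist_notempty[OF False] by (intro cINF_greatest False)
    moreover have "2 / \<epsilon> \<le> real (m + M)" unfolding M_def by linarith
    ultimately have "2 / \<epsilon> * (\<epsilon> / 2) \<le> real (m + M) * infdist z K"
      using \<epsilon> by (intro mult_mono) auto
    then show ?thesis using \<epsilon> by (simp add: f_def)
  qed
  have f_lim: "(\<lambda>m. f m z) \<longlonglongrightarrow> indicator K z" for z
  proof (cases "z \<in> K")
    case True
    then show ?thesis by (simp add: f_def)
  next
    case z: False
    then have "infdist z K > 0"
      using K(1) False by (metis in_closed_iff_infdist_zero infdist_nonneg less_le)
    then obtain N where N: "real N * infdist z K > 1"
      using ex_less_of_nat_mult by blast
    have "f m z = 0" if "m \<ge> N" for m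
    proof -
      have "real N * infdist z K \<le> real (m + M) * infdist z K"
        using that by (intro mult_right_mono) (auto simp: infdist_nonneg)
      then show ?thesis using N by (simp add: f_def)
    qed
    then have "eventually (\<lambda>m. f m z = indicator K z) sequentially"
      using z by (auto simp: eventually_sequentially)
    then show ?thesis by (rule tendsto_eventually)
  qed
  have Km: "K \<inter> sphere 0 1 \<in> sets \<mu>"
    using K(1) by (auto simp: sets sets_circle_borel_iff intro!: borel_closed)
  have dm: "circle_density \<alpha> \<in> borel_measurable circle_lebesgue"
    using borel_measurable_circle_density[OF \<kappa>_pos \<kappa>_le bv lim0] measurable_restrict_space1 measurable_cong_sets[OF setsL refl] by blast
  have indm: "(indicator K :: complex \<Rightarrow> real) \<in> borel_measurable N" if "sets N = sets circle_borel" for N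
    using K(1) measurable_restrict_space1[of "indicator K :: complex \<Rightarrow> real" borel borel "sphere 0 1"] measurable_cong_sets[OF that refl]
    by (metis borel_closed borel_measurable_indicator)
  obtain B where B: "\<And>z. cmod z = 1 \<Longrightarrow> \<epsilon> / 2 \<le> cmod (z - 1) \<Longrightarrow> \<bar>ln_limit \<alpha> z\<bar> \<le> B"
    using ln_limit_bounded[OF \<kappa>_pos \<kappa>_le bv lim0, of "\<epsilon> / 2"] \<epsilon> half_gt_zero by blast
  have bd: "\<bar>f m z * circle_density \<alpha> z\<bar> \<le> exp B" if z: "z \<in> space circle_lebesgue" for m z
  proof (cases "cmod (z - 1) < \<epsilon> / 2")
    case True
    then show ?thesis by (simp add: f0)
  next
    case False
    then have "circle_density \<alpha> z \<le> exp B"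
      using B[of z] z space by (auto simp: circle_density_def indicator_def)
    then have "f m z * circle_density \<alpha> z \<le> 1 * exp B"
      using f_bd[of m z] circle_density_nonneg by (intro mult_mono) auto
    then show ?thesis using f_bd[of m z] circle_density_nonneg[of \<alpha> z] by simp
  qed
  have l1: "(\<lambda>m. LINT z|\<mu>. f m z) \<longlonglongrightarrow> (LINT z|\<mu>. indicator K z)"
    by (rule integral_dominated_convergence[where w = "\<lambda>_. 1"])
      (use f_bd f_lim indm[OF sets] continuous_on_circle_integrable(1)[OF \<mu> f_cont] in auto)
  have l2: "(\<lambda>m. LINT z|circle_lebesgue. f m z * circle_density \<alpha> z)
      \<longlonglongrightarrow> (LINT z|circle_lebesgue. indicator K z * circle_density \<alpha> z)"
    by (rule integral_dominated_convergence[where w = "\<lambda>_. exp B"])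
      (use bd f_lim indm[OF setsL] continuous_on_circle_integrable(1)[OF circle_prob_measure_lebesgue f_cont] dm
        in \<open>auto intro!: tendsto_mult borel_measurable_times AE_I2\<close>)
  have l3: "(LINT z|\<mu>. f m z) = (LINT z|circle_lebesgue. f m z * circle_density \<alpha> z)" for m
    using \<epsilon> f0 by (intro integral_eq_circle_density[of "\<epsilon> / 2"] f_cont) auto
  have eq: "(LINT z|\<mu>. indicator K z) = (LINT z|circle_lebesgue. indicator K z * circle_density \<alpha> z)"
    using LIMSEQ_unique[OF l1[unfolded l3] l2] .
  have "(\<integral>\<^sup>+z. ennreal (indicator K z * circle_density \<alpha> z) \<partial>circle_lebesgue)
      = ennreal (LINT z|circle_lebesgue. indicator K z * circle_density \<alpha> z)"
  proof (rule nn_integral_eq_integral)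
    have "norm (indicator K z * circle_density \<alpha> z) \<le> exp B" if z: "z \<in> space circle_lebesgue" for z
    proof -
      have "(\<lambda>m. \<bar>f m z * circle_density \<alpha> z\<bar>) \<longlonglongrightarrow> \<bar>indicator K z * circle_density \<alpha> z\<bar>"
        by (intro tendsto_intros f_lim)
      then have "\<bar>indicator K z * circle_density \<alpha> z\<bar> \<le> exp B"
        by (rule tendsto_upperbound) (use bd[OF z] in auto)
      then show ?thesis by simp
    qed
    then show "integrable circle_lebesgue (\<lambda>z. indicator K z * circle_density \<alpha> z)"
      using indm[OF setsL] dm by (intro L.integrable_const_bound[of _ "exp B"] AE_I2) auto
  qed (simp add: circle_density_nonneg)
  also have "\<dots> = ennreal (LINT z|\<mu>. indicator K z)" by (simp only: eq)
  also have "\<dots> = emeasure \<mu> (K \<inter> sphere 0 1)"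
    using Km by (simp add: emeasure_eq_measure space)
  finally show ?thesis by simp
qed simp

text \<open>Closed sets are an intersection-stable generator of the Borel sets. Both sides are
  turned into measures on the plane and cut down to \<open>C\<close>, so that each closed set is
  only tested through its part \<open>X \<inter> C\<close> at distance at least \<epsilon> from
  \<open>1\<close>.\<close>

lemma emeasure_eq_circle_density:
  assumes \<epsilon>: "\<epsilon> > 0" and A: "A \<in> sets circle_borel" "\<And>z. z \<in> A \<Longrightarrow> \<epsilon> \<le> cmod (z - 1)"
  shows "emeasure \<mu> A = (\<integral>\<^sup>+\<theta>. ennreal (circle_density \<alpha> (cis \<theta>)) * indicator A (cis \<theta>) \<partial>angle_measure)"
proof -
  interpret prob_space \<mu> using \<mu> by (simp add: circle_prob_measure_def)
  define C where "C = {z::complex. \<epsilon> \<le> cmod (z - 1)}"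
  have C: "closed C" unfolding C_def by (intro closed_Collect_le continuous_intros)
  have sets: "sets \<mu> = sets circle_borel" using \<mu> by (simp add: circle_prob_measure_def)
  have id: "(\<lambda>z. z) \<in> measurable N borel" if "sets N = sets circle_borel" for N
    using measurable_restrict_space1[of "\<lambda>z::complex. z" borel borel "sphere 0 1"] measurable_cong_sets[OF that refl] by auto
  have setsL: "sets circle_lebesgue = sets circle_borel" by (simp add: circle_lebesgue_def)
  have dm: "circle_density \<alpha> \<in> borel_measurable borel" by (rule borel_measurable_circle_density[OF \<kappa>_pos \<kappa>_le bv lim0])
  define M1 where "M1 = density (distr \<mu> borel (\<lambda>z. z)) (indicator C)"
  define M2 where "M2 = density (distr circle_lebesgue borel (\<lambda>z. z)) (\<lambda>z. ennreal (indicator C z * circle_density \<alpha> z))"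
  have E1: "emeasure M1 X = emeasure \<mu> (X \<inter> C \<inter> sphere 0 1)" if X: "X \<in> sets borel" for X
  proof -
    have "emeasure M1 X = (\<integral>\<^sup>+z. indicator (X \<inter> C) z \<partial>distr \<mu> borel (\<lambda>z. z))"
    proof -
      have "emeasure M1 X = (\<integral>\<^sup>+z. indicator C z * indicator X z \<partial>distr \<mu> borel (\<lambda>z. z))"
        unfolding M1_def using X C by (intro emeasure_density) auto
      then show ?thesis by (simp add: indicator_inter_arith mult.commute)
    qed
    also have "\<dots> = emeasure (distr \<mu> borel (\<lambda>z. z)) (X \<inter> C)"
      using X C by (intro nn_integral_indicator) auto
    also have "\<dots> = emeasure \<mu> (X \<inter> C \<inter> sphere 0 1)"
      using X C id[OF sets] by (subst emeasure_distr) (auto simp: circle_prob_measure_space[OF \<mu>])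
    finally show ?thesis .
  qed
  have E2: "emeasure M2 X = (\<integral>\<^sup>+z. ennreal (indicator (X \<inter> C) z * circle_density \<alpha> z) \<partial>circle_lebesgue)"
    if X: "X \<in> sets borel" for X
  proof -
    have "emeasure M2 X = (\<integral>\<^sup>+z. ennreal (indicator C z * circle_density \<alpha> z) * indicator X z \<partial>distr circle_lebesgue borel (\<lambda>z. z))"
      unfolding M2_def using X C dm by (intro emeasure_density) auto
    also have "\<dots> = (\<integral>\<^sup>+z. ennreal (indicator C z * circle_density \<alpha> z) * indicator X z \<partial>circle_lebesgue)"
      using X C dm id[OF setsL] by (intro nn_integral_distr) auto
    also have "\<dots> = (\<integral>\<^sup>+z. ennreal (indicator (X \<inter> C) z * circle_density \<alpha> z) \<partial>circle_lebesgue)"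
      by (intro nn_integral_cong) (auto simp: indicator_def)
    finally show ?thesis .
  qed
  have "M1 = M2"
  proof (rule measure_eqI_generator_eq[where E = "Collect closed" and \<Omega> = UNIV and A = "\<lambda>_. UNIV"])
    show "Int_stable (Collect closed :: complex set set)" by (auto simp: Int_stable_def)
    show "emeasure M1 X = emeasure M2 X" if "X \<in> Collect closed" for X
      using that C measure_closed_eq_circle_density[OF \<epsilon>, of "X \<inter> C"]
      by (simp add: E1 E2 closed_Int) (simp add: C_def)
    show "sets M1 = sigma_sets UNIV (Collect closed)" "sets M2 = sigma_sets UNIV (Collect closed)"
      by (simp_all add: M1_def M2_def borel_eq_closed)
    show "emeasure M1 UNIV \<noteq> \<infinity>" by (simp add: E1)
  qed auto
  have A': "A \<in> sets borel" "A \<subseteq> sphere 0 1" "A \<subseteq> C"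
    using A by (auto simp: sets_circle_borel_iff C_def)
  then have AC: "A \<inter> C \<inter> sphere 0 1 = A" "A \<inter> C = A" by auto
  have "emeasure \<mu> A = emeasure M2 A" using E1[OF A'(1)] AC \<open>M1 = M2\<close> by simp
  also have "\<dots> = (\<integral>\<^sup>+z. ennreal (indicator A z * circle_density \<alpha> z) \<partial>circle_lebesgue)"
    using E2[OF A'(1)] AC by simp
  also have "\<dots> = (\<integral>\<^sup>+\<theta>. ennreal (indicator A (cis \<theta>) * circle_density \<alpha> (cis \<theta>)) \<partial>angle_measure)"
    using A' dm by (intro nn_integral_circle_lebesgue measurable_restrict_space1) auto
  also have "\<dots> = (\<integral>\<^sup>+\<theta>. ennreal (circle_density \<alpha> (cis \<theta>)) * indicator A (cis \<theta>) \<partial>angle_measure)"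
    by (intro nn_integral_cong) (auto simp: indicator_def)
  finally show ?thesis .
qed

section \<open>Comparison with a given Lebesgue decomposition\<close>

context
  fixes w :: "real \<Rightarrow> real" and \<mu>s :: "complex measure"
  assumes dec: "circle_lebesgue_decomposition \<mu> w \<mu>s"
begin

lemma emeasure_abs_cont:
  assumes f: "f \<in> borel_measurable borel" and A: "A \<in> sets circle_borel"
  shows "emeasure (distr (density angle_measure (\<lambda>\<theta>. ennreal (f \<theta>))) circle_borel cis) A
    = (\<integral>\<^sup>+\<theta>. ennreal (f \<theta>) * indicator A (cis \<theta>) \<partial>angle_measure)"
proof -
  have s: "sets angle_measure = sets borel" "space angle_measure = UNIV" by (simp_all add: angle_measure_def)
  have c: "cis \<in> measurable (density angle_measure (\<lambda>\<theta>. ennreal (f \<theta>))) circle_borel"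
    using measurable_cis s by (simp cong: measurable_cong_sets)
  have v: "cis -` A \<in> sets borel" using measurable_sets[OF measurable_cis A] by simp
  have "emeasure (distr (density angle_measure (\<lambda>\<theta>. ennreal (f \<theta>))) circle_borel cis) A
     = emeasure (density angle_measure (\<lambda>\<theta>. ennreal (f \<theta>))) (cis -` A)"
    using emeasure_distr[OF c A] s by simp
  also have "\<dots> = (\<integral>\<^sup>+\<theta>. ennreal (f \<theta>) * indicator (cis -` A) \<theta> \<partial>angle_measure)"
    using f v s by (intro emeasure_density) (auto cong: measurable_cong_sets)
  also have "\<dots> = (\<integral>\<^sup>+\<theta>. ennreal (f \<theta>) * indicator A (cis \<theta>) \<partial>angle_measure)"
    by (simp add: indicator_def)
  finally show ?thesis .
qed

text \<open>Let N be a Lebesgue-null set that carries \<mu>s. The part of \<open>A\<close> off N is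
  null for \<mu>s by choice; the part in N is null for \<mu> by the density formula, and \<mu>
  dominates \<mu>s.\<close>

lemma singular_part_vanishes:
  assumes \<epsilon>: "\<epsilon> > 0" and A: "A \<in> sets circle_borel" "\<And>z. z \<in> A \<Longrightarrow> \<epsilon> \<le> cmod (z - 1)"
  shows "emeasure \<mu>s A = 0"
proof -
  obtain N where N: "N \<in> sets circle_borel" "emeasure circle_lebesgue N = 0" "emeasure \<mu>s (sphere 0 1 - N) = 0"
    using dec unfolding circle_lebesgue_decomposition_def by blast
  have sets: "sets \<mu>s = sets circle_borel" using dec by (simp add: circle_lebesgue_decomposition_def)
  have AN: "A \<inter> N \<in> sets circle_borel" using A N by auto
  have "emeasure \<mu> (A \<inter> N) = (\<integral>\<^sup>+\<theta>. ennreal (circle_density \<alpha> (cis \<theta>)) * indicator (A \<inter> N) (cis \<theta>) \<partial>angle_measure)"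
    using A AN by (intro emeasure_eq_circle_density[OF \<epsilon>]) auto
  also have "\<dots> = (\<integral>\<^sup>+z. ennreal (circle_density \<alpha> z) * indicator (A \<inter> N) z \<partial>circle_lebesgue)"
    using AN borel_measurable_circle_density[OF \<kappa>_pos \<kappa>_le bv lim0]
    by (intro nn_integral_circle_lebesgue[symmetric] borel_measurable_times measurable_restrict_space1 measurable_compose[OF borel_measurable_circle_density[OF \<kappa>_pos \<kappa>_le bv lim0]])
      (auto simp: sets_circle_borel_iff)
  also have "\<dots> = 0"
  proof -
    have "N \<in> null_sets circle_lebesgue" using N by (auto simp: null_sets_def circle_lebesgue_def)
    then have "AE z in circle_lebesgue. ennreal (circle_density \<alpha> z) * indicator (A \<inter> N) z = 0"
      using AE_not_in[of N circle_lebesgue] by (auto elim!: eventually_mono simp: indicator_def)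
    then show ?thesis by (subst nn_integral_cong_AE[where v = "\<lambda>_. 0"]) auto
  qed
  finally have "emeasure \<mu>s (A \<inter> N) = 0"
    using dec AN unfolding circle_lebesgue_decomposition_def by (metis add_eq_0_iff_both_eq_0 zero_le)
  moreover have "emeasure \<mu>s (A - N) \<le> emeasure \<mu>s (sphere 0 1 - N)"
    using A N sets by (intro emeasure_mono) (auto simp: sets_circle_borel_iff)
  moreover have "emeasure \<mu>s A \<le> emeasure \<mu>s (A \<inter> N) + emeasure \<mu>s (A - N)"
  proof -
    have "emeasure \<mu>s ((A \<inter> N) \<union> (A - N)) \<le> emeasure \<mu>s (A \<inter> N) + emeasure \<mu>s (A - N)"
      using A N sets by (intro emeasure_subadditive) auto
    moreover have "(A \<inter> N) \<union> (A - N) = A" by auto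
    ultimately show ?thesis by simp
  qed
  ultimately show ?thesis using N(3) by simp
qed

lemma measure_support_singular_part: "measure_support \<mu>s \<subseteq> {1}"
proof
  fix z assume z: "z \<in> measure_support \<mu>s"
  show "z \<in> {1}"
  proof (rule ccontr)
    assume "z \<notin> {1}"
    then have z1: "cmod (z - 1) > 0" by simp
    define U where "U = {x::complex. cmod (z - 1) / 2 < cmod (x - 1)}"
    have sets: "sets \<mu>s = sets circle_borel" using dec by (simp add: circle_lebesgue_decomposition_def)
    then have space: "space \<mu>s = sphere 0 1"
      by (metis Int_UNIV_right sets_eq_imp_space_eq space_borel space_restrict_space)
    have "open U" unfolding U_def by (intro open_Collect_less continuous_intros)
    moreover have "z \<in> U" using z1 by (simp add: U_def)
    ultimately have "emeasure \<mu>s (U \<inter> space \<mu>s) > 0"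
      using z by (simp add: measure_support_def)
    moreover have "emeasure \<mu>s (U \<inter> space \<mu>s) = 0"
      using \<open>open U\<close> z1
      by (intro singular_part_vanishes[of "cmod (z - 1) / 2"]) (auto simp: space sets_circle_borel_iff U_def)
    ultimately show False by simp
  qed
qed

text \<open>Where \<open>cis \<theta>\<close> has distance at least \<open>1 / Suc m\<close> from
  \<open>1\<close>, both functions are densities of the same measure, hence equal almost everywhere.
  Over all m this leaves a single angle of the period.\<close>

lemma AE_density_eq: "AE \<theta> in angle_measure. circle_density \<alpha> (cis \<theta>) = w \<theta>"
proof -
  interpret prob_space angle_measure by (rule prob_space_angle_measure)
  have s: "sets angle_measure = sets borel" "space angle_measure = UNIV" by (simp_all add: angle_measure_def)
  have w: "w \<in> borel_measurable borel" "\<And>\<theta>. 0 \<le> w \<theta>"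
    using dec by (auto simp: circle_lebesgue_decomposition_def)
  have cisb: "cis \<in> measurable borel borel" by (intro borel_measurable_continuous_onI continuous_intros)
  have v: "(\<lambda>\<theta>. circle_density \<alpha> (cis \<theta>)) \<in> borel_measurable borel"
    by (rule measurable_compose[OF cisb borel_measurable_circle_density[OF \<kappa>_pos \<kappa>_le bv lim0]])
  have "AE \<theta> in angle_measure. \<forall>m::nat. 1 / Suc m \<le> cmod (cis \<theta> - 1) \<longrightarrow> circle_density \<alpha> (cis \<theta>) = w \<theta>"
  proof (subst AE_all_countable, intro allI)
    fix m :: nat
    define C where "C = {z::complex. 1 / Suc m \<le> cmod (z - 1)}"
    have C: "C \<in> sets borel" unfolding C_def by (intro borel_closed closed_Collect_le continuous_intros)
    note [measurable] = v w(1) C cisb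
    have s2: "borel_measurable angle_measure = borel_measurable borel"
      by (intro measurable_cong_sets s refl)
    have "AE \<theta> in angle_measure. ennreal (circle_density \<alpha> (cis \<theta>)) * indicator C (cis \<theta>) = ennreal (w \<theta>) * indicator C (cis \<theta>)"
    proof (rule density_unique_finite_measure)
      show "(\<lambda>\<theta>. ennreal (circle_density \<alpha> (cis \<theta>)) * indicator C (cis \<theta>)) \<in> borel_measurable angle_measure"
        unfolding s2 by measurable
      show "(\<lambda>\<theta>. ennreal (w \<theta>) * indicator C (cis \<theta>)) \<in> borel_measurable angle_measure"
        unfolding s2 by measurable
    next
      fix X assume "X \<in> sets angle_measure"
      then have X: "X \<in> sets borel" using s by simp
      \<comment> \<open>The points of the circle whose angle lies in \<open>X\<close>:
        \<open>Arg2pi\<close> inverts \<open>cis\<close> on the half-open period that carries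
        \<open>angle_measure\<close>.\<close>
      define A where "A = {z \<in> sphere 0 1. z \<in> C \<and> Arg2pi z \<in> X}"
      have "A = sphere 0 1 \<inter> C \<inter> (Arg2pi -` X \<inter> space borel)" by (auto simp: A_def)
      then have A: "A \<in> sets circle_borel"
        using C measurable_sets[OF borel_measurable_Arg2pi X] by (auto simp: sets_circle_borel_iff)
      have ind: "AE \<theta> in angle_measure. indicator C (cis \<theta>) * indicator X \<theta> = (indicator A (cis \<theta>) :: ennreal)"
        unfolding AE_angle_measure
        by (intro AE_I2) (auto simp: A_def indicator_def Arg2pi_cis)
      have eq: "(\<integral>\<^sup>+\<theta>. ennreal (f \<theta>) * indicator C (cis \<theta>) * indicator X \<theta> \<partial>angle_measure) =
          (\<integral>\<^sup>+\<theta>. ennreal (f \<theta>) * indicator A (cis \<theta>) \<partial>angle_measure)" for f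
        using ind by (intro nn_integral_cong_AE) (auto elim!: eventually_mono simp: mult.assoc)
      have "(\<integral>\<^sup>+\<theta>. ennreal (circle_density \<alpha> (cis \<theta>)) * indicator A (cis \<theta>) \<partial>angle_measure) = emeasure \<mu> A"
        using A by (intro emeasure_eq_circle_density[of "1 / Suc m", symmetric]) (auto simp: A_def C_def)
      also have "\<dots> = emeasure (distr (density angle_measure (\<lambda>\<theta>. ennreal (w \<theta>))) circle_borel cis) A + emeasure \<mu>s A"
        using dec A by (simp add: circle_lebesgue_decomposition_def)
      also have "emeasure \<mu>s A = 0"
        using A by (intro singular_part_vanishes[of "1 / Suc m"]) (auto simp: A_def C_def)
      finally show "(\<integral>\<^sup>+\<theta>. ennreal (circle_density \<alpha> (cis \<theta>)) * indicator C (cis \<theta>) * indicator X \<theta> \<partial>angle_measure) =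
         (\<integral>\<^sup>+\<theta>. ennreal (w \<theta>) * indicator C (cis \<theta>) * indicator X \<theta> \<partial>angle_measure)"
        unfolding eq using emeasure_abs_cont[OF w(1) A] by simp
    qed auto
    then show "AE \<theta> in angle_measure. 1 / Suc m \<le> cmod (cis \<theta> - 1) \<longrightarrow> circle_density \<alpha> (cis \<theta>) = w \<theta>"
      by eventually_elim (use w(2) circle_density_nonneg in \<open>auto simp: C_def\<close>)
  qed
  moreover have "AE \<theta> in angle_measure. cis \<theta> \<noteq> 1"
  proof -
    have "AE \<theta> in lborel. \<theta> \<noteq> (0::real)" by (rule AE_lborel_singleton)
    then show ?thesis
      unfolding AE_angle_measure
    proof eventually_elim
      case (elim \<theta>)
      then show ?case using Arg2pi_cis[of \<theta>] Arg2pi_cis[of 0] by auto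
    qed
  qed
  ultimately show ?thesis
  proof eventually_elim
    case (elim \<theta>)
    then have "cmod (cis \<theta> - 1) > 0" by simp
    then obtain m where "inverse (real (Suc m)) < cmod (cis \<theta> - 1)" using reals_Archimedean by blast
    then show ?case using elim(1)[rule_format, of m] by (simp add: inverse_eq_divide)
  qed
qed

text \<open>Changing the density on a null set leaves the absolutely continuous part alone, so
  \<mu>s is kept. Periodicity spreads the equality from one period to the line.\<close>

lemma circle_lebesgue_decomposition_density:
  "circle_lebesgue_decomposition \<mu> (\<lambda>\<theta>. circle_density \<alpha> (cis \<theta>)) \<mu>s"
  "AE \<theta> in lborel. circle_density \<alpha> (cis \<theta>) = w \<theta>"
proof -
  have w: "w \<in> borel_measurable borel" "\<And>\<theta>. w (\<theta> + 2 * pi) = w \<theta>"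
    using dec by (auto simp: circle_lebesgue_decomposition_def)
  have cisb: "cis \<in> measurable borel borel" by (intro borel_measurable_continuous_onI continuous_intros)
  have v: "(\<lambda>\<theta>. circle_density \<alpha> (cis \<theta>)) \<in> borel_measurable borel"
    by (rule measurable_compose[OF cisb borel_measurable_circle_density[OF \<kappa>_pos \<kappa>_le bv lim0]])
  have per: "circle_density \<alpha> (cis (\<theta> + 2 * pi)) = circle_density \<alpha> (cis \<theta>)" for \<theta>
    by (simp flip: cis_mult)
  show "AE \<theta> in lborel. circle_density \<alpha> (cis \<theta>) = w \<theta>"
    by (rule AE_periodic[OF v w(1) per w(2) AE_density_eq])
  have "emeasure (distr (density angle_measure (\<lambda>\<theta>. ennreal (circle_density \<alpha> (cis \<theta>)))) circle_borel cis) A =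
      emeasure (distr (density angle_measure (\<lambda>\<theta>. ennreal (w \<theta>))) circle_borel cis) A"
    if A: "A \<in> sets circle_borel" for A
    unfolding emeasure_abs_cont[OF v A] emeasure_abs_cont[OF w(1) A]
    using AE_density_eq by (intro nn_integral_cong_AE) (auto elim!: eventually_mono)
  then show "circle_lebesgue_decomposition \<mu> (\<lambda>\<theta>. circle_density \<alpha> (cis \<theta>)) \<mu>s"
    using dec v per circle_density_nonneg by (simp add: circle_lebesgue_decomposition_def)
qed

end

end

text \<open>Since \<open>w\<close> is fixed only up to null sets, the pointwise claims are made for
  a representative \<open>v\<close> that forms a decomposition with the same \<mu>s. The witness is
  \<open>circle_density\<close> composed with \<open>cis\<close>.\<close>

theorem theorem1p5:
  fixes \<mu> \<mu>s :: "complex measure" and w :: "real \<Rightarrow> real" and \<alpha> :: "nat \<Rightarrow> complex" and p :: nat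
  assumes "circle_prob_measure \<mu>"
    and "infinite (measure_support \<mu>)"
    and "verblunsky_coefficients \<mu> \<alpha>"
    and "circle_lebesgue_decomposition \<mu> w \<mu>s"
    and "in_little_l 1 (forward_diff \<alpha>)"
    and "p \<ge> 1"
    and "in_little_l p \<alpha>"
  shows "measure_support \<mu>s \<subseteq> {1} \<and>
    (\<exists>v. circle_lebesgue_decomposition \<mu> v \<mu>s \<and> (AE \<theta> in lborel. v \<theta> = w \<theta>) \<and>
      continuous_on {\<theta>. cis \<theta> \<noteq> 1} v \<and>
      (\<forall>\<theta>. cis \<theta> \<noteq> 1 \<longrightarrow> v \<theta> > 0) \<and>
      (\<lambda>\<theta>. \<bar>ln (v \<theta>)\<bar>) \<in> O[at 0](\<lambda>\<theta>. 1 / \<bar>\<theta>\<bar> ^ (p - 1)))"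
proof -
  have lim0: "\<alpha> \<longlonglongrightarrow> 0" by (rule in_little_l_tendsto_0[OF assms(6,7)])
  have "cmod (\<alpha> n) < 1" for n using assms(3) by (simp add: verblunsky_coefficients_def)
  then obtain \<kappa> where \<kappa>: "\<kappa> > 0" "\<And>n. \<kappa> \<le> 1 - (cmod (\<alpha> n))\<^sup>2"
    using coeff_bounded_away[OF _ lim0] by metis
  have bv: "summable (\<lambda>n. cmod (\<alpha> (Suc n) - \<alpha> n))"
    using assms(5) by (simp add: in_little_l_def forward_diff_def)
  note facts = assms(1,3) \<kappa> bv lim0
  let ?v = "\<lambda>\<theta>. circle_density \<alpha> (cis \<theta>)"
  show ?thesis
  proof (intro conjI exI[of _ ?v])
    show "measure_support \<mu>s \<subseteq> {1}"
      by (rule measure_support_singular_part[OF facts assms(4)])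
    show "circle_lebesgue_decomposition \<mu> ?v \<mu>s" "AE \<theta> in lborel. ?v \<theta> = w \<theta>"
      by (rule circle_lebesgue_decomposition_density[OF facts assms(4)])+
    show "continuous_on {\<theta>. cis \<theta> \<noteq> 1} ?v"
      by (rule continuous_on_circle_density[OF \<kappa> bv lim0])
    show "\<forall>\<theta>. cis \<theta> \<noteq> 1 \<longrightarrow> ?v \<theta> > 0" by (simp add: circle_density_def)
    show "(\<lambda>\<theta>. \<bar>ln (?v \<theta>)\<bar>) \<in> O[at 0](\<lambda>\<theta>. 1 / \<bar>\<theta>\<bar> ^ (p - 1))"
      by (rule ln_circle_density_bigo[OF \<kappa> bv lim0 assms(6,7)])
  qed
qed

end
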